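(* Let $n\ge2$ and $B\ge1$ be integers, let $0<\alpha<1$, and let $P_0=\mathcal{N}(0,\Sigma)$ be a Gaussian distribution on $H(k)$ whose covariance operator $\Sigma_{op}$ has largest eigenvalue smaller than $1$. Let $n\hat L^2$ be the L-MMD statistic computed from i.i.d. $Y_1,\dots,Y_n\sim P$, and let $\hat q_{\alpha,n}$ be the Monte-Carlo quantile estimator $$\hat q_{\alpha,n}=n\hat L^2_{(\ell)},\qquad \ell=\lfloor B+2-\alpha(B+1)\rfloor,$$ the $\ell$-th smallest value among $B$ i.i.d. copies of the statistic drawn under $P_0$, independently of $Y_1,\dots,Y_n$. Assume $P=P_0$ and $\alpha\ge 1/(B+1)$. Then $$\alpha-\frac{1}{B+1}\ \le\ \mathbb{P}\left(n\hat L^2>\hat q_{\alpha,n}\right)\ \le\ \alpha .$$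
   Context: $k$ is a positive definite kernel on a set $\mathcal{X}$ with reproducing kernel Hilbert space $H(k)$ (inner product $\langle\cdot,\cdot\rangle$). The observations are $X_1,\dots,X_n\in\mathcal{X}$ i.i.d., and $Y_i=k(X_i,\cdot)\in H(k)$ has distribution $P$. $Z\sim\mathcal{N}(0,\Sigma)$ in $H(k)$ means that $\langle Z,f\rangle$ is a centered univariate Gaussian for every $f\in H(k)$, with (finite trace) covariance operator $\Sigma_{op}$ given by $\langle\Sigma_{op}f,g\rangle=\mathrm{cov}(\langle Z,f\rangle,\langle Z,g\rangle)$; the covariance function is $\Sigma(x,y)=\langle\Sigma_{op}k(x,\cdot),k(y,\cdot)\rangle$. L-MMD statistic: $$n\hat L^2=\frac1{n-1}\sum_{i\ne j}e^{\langle Y_i,Y_j\rangle}-2\sum_{i=1}^n e^{\frac12\langle Y_i,\Sigma_{op}Y_i\rangle}+n b^2,\qquad b^2=[\det(I-\Sigma_{op}^2)]^{-1/2},$$ where $\langle Y_i,Y_j\rangle=k(X_i,X_j)$ and $\langle Y_i,\Sigma_{op}Y_i\rangle=\Sigma(X_i,X_i)$. Monte-Carlo copies: for $b=1,\dots,B$, the $b$-th copy is given by the same formula with $Y_1,\dots,Y_n$ replaced by i.i.d. $Z^{(b)}_1,\dots,Z^{(b)}_n\sim P_0$, all independent of each other and of the $Y_i$. The copies are ordered increasingly, $n\hat L^2_{(1)}\le\dots\le n\hat L^2_{(B)}$. Here $\lfloor\cdot\rfloor$ denotes the integer part.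
   Formalization: The lower bound is proved for Σ_op ≠ 0; for Σ_op = 0 the statistic is a.s. constant, the rejection probability is 0, and the bound fails when α > 1/(B+1). If α = 1/(B+1), then ℓ = B+1 and the quantile is taken to be +∞. *)

theory Defs
  imports "HOL-Probability.Probability"
begin

definition pd_kernel :: "'x set \<Rightarrow> ('x \<Rightarrow> 'x \<Rightarrow> real) \<Rightarrow> bool" where
  "pd_kernel \<X> k \<longleftrightarrow>
     (\<forall>x\<in>\<X>. \<forall>y\<in>\<X>. k x y = k y x) \<and>
     (\<forall>A c. finite A \<and> A \<subseteq> \<X> \<longrightarrow> (\<Sum>x\<in>A. \<Sum>y\<in>A. c x * c y * k x y) \<ge> 0)"

text \<open>
  The Hilbert space type \<open>'h\<close>, together with the evaluation map \<open>app\<close>, is the RKHS of \<open>k\<close> on \<open>\<X>\<close>: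
  an element \<open>f\<close> of \<open>'h\<close> stands for the function \<open>x \<mapsto> app f x\<close> on \<open>\<X>\<close>.  Distinct elements are
  distinct functions, \<open>K x\<close> is the section \<open>k(x, -)\<close>, and the reproducing property holds; the latter
  makes the vector space operations of \<open>'h\<close> the pointwise ones.  By the Moore-Aronszajn theorem this
  determines \<open>'h\<close> up to the isometry that respects evaluation.
\<close>

definition is_rkhs ::
  "'x set \<Rightarrow> ('x \<Rightarrow> 'x \<Rightarrow> real) \<Rightarrow> ('h::{real_inner,banach} \<Rightarrow> 'x \<Rightarrow> real) \<Rightarrow> ('x \<Rightarrow> 'h) \<Rightarrow> bool" where
  "is_rkhs \<X> k app K \<longleftrightarrow>
     pd_kernel \<X> k \<and>
     (\<forall>f g. (\<forall>x\<in>\<X>. app f x = app g x) \<longrightarrow> f = g) \<and>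
     (\<forall>x\<in>\<X>. \<forall>y\<in>\<X>. app (K x) y = k x y) \<and>
     (\<forall>f. \<forall>x\<in>\<X>. app f x = f \<bullet> K x)"

text \<open>
  A random element of a (possibly non-separable) Hilbert space: a pointwise limit of simple functions.
  If the space is separable this is the same as Borel measurability.  In general, Borel measurability
  alone would not make \<open>\<omega> \<mapsto> Y \<omega> \<bullet> Y' \<omega>\<close> measurable.
\<close>

definition random_element :: "'w measure \<Rightarrow> ('w \<Rightarrow> 'h::real_normed_vector) \<Rightarrow> bool" where
  "random_element M Y \<longleftrightarrow>
     (\<exists>s. (\<forall>j::nat. simple_function M (s j)) \<and> (\<forall>\<omega>\<in>space M. (\<lambda>j. s j \<omega>) \<longlonglongrightarrow> Y \<omega>))"

definition orthonormal_basis :: "'h::real_inner set \<Rightarrow> bool" where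
  "orthonormal_basis E \<longleftrightarrow>
     pairwise orthogonal E \<and> (\<forall>e\<in>E. norm e = 1) \<and> closure (span E) = UNIV"

text \<open>
  Finite trace, for a positive operator; for such operators neither the finiteness nor the value of
  the sum depends on the orthonormal basis.
\<close>

definition finite_trace :: "('h::real_inner \<Rightarrow> 'h) \<Rightarrow> bool" where
  "finite_trace T \<longleftrightarrow> (\<exists>E. orthonormal_basis E \<and> (\<lambda>e. T e \<bullet> e) summable_on E)"

definition cov :: "'w measure \<Rightarrow> ('w \<Rightarrow> real) \<Rightarrow> ('w \<Rightarrow> real) \<Rightarrow> real" where
  "cov M U V = (\<integral>\<omega>. (U \<omega> - (\<integral>\<xi>. U \<xi> \<partial>M)) * (V \<omega> - (\<integral>\<xi>. V \<xi> \<partial>M)) \<partial>M)"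

text \<open>The degenerate Gaussian, the Dirac measure at 0, is included.\<close>

definition centered_gaussian :: "real measure \<Rightarrow> bool" where
  "centered_gaussian \<mu> \<longleftrightarrow>
     \<mu> = return borel 0 \<or>
     (\<exists>\<sigma>>0. \<mu> = density lborel (\<lambda>x. ennreal (normal_density 0 \<sigma> x)))"

text \<open>\<open>P = N(0, \<Sigma>)\<close>, where \<open>S\<close> is the covariance operator.\<close>

definition gaussian_measure :: "'h::{real_inner,banach} measure \<Rightarrow> ('h \<Rightarrow> 'h) \<Rightarrow> bool" where
  "gaussian_measure P S \<longleftrightarrow>
     prob_space P \<and> sets P = sets borel \<and>
     (\<forall>f. centered_gaussian (distr P borel (\<lambda>z. z \<bullet> f))) \<and>
     bounded_linear S \<and> finite_trace S \<and>
     (\<forall>f g. S f \<bullet> g = cov P (\<lambda>z. z \<bullet> f) (\<lambda>z. z \<bullet> g))"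

definition eigenspace :: "('h::real_vector \<Rightarrow> 'h) \<Rightarrow> real \<Rightarrow> 'h set" where
  "eigenspace T l = {v. T v = l *\<^sub>R v}"

definition eigenvalues :: "('h::real_vector \<Rightarrow> 'h) \<Rightarrow> real set" where
  "eigenvalues T = {l. \<exists>v. v \<noteq> 0 \<and> v \<in> eigenspace T l}"

text \<open>
  The Fredholm determinant \<open>det (I + T)\<close> of a self-adjoint trace class operator \<open>T\<close>: the product of
  \<open>1 + l\<close> over the nonzero eigenvalues \<open>l\<close> of \<open>T\<close>, counted with multiplicity.
\<close>

definition fredholm_det :: "('h::real_vector \<Rightarrow> 'h) \<Rightarrow> real" where
  "fredholm_det T =
     Lim (finite_subsets_at_top (eigenvalues T - {0})) (\<lambda>F. \<Prod>l\<in>F. (1 + l) ^ dim (eigenspace T l))"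

text \<open>\<open>b\<^sup>2 = det (I - \<Sigma>\<^sup>2) ^ (-1/2)\<close>\<close>

definition b_squared :: "('h::real_vector \<Rightarrow> 'h) \<Rightarrow> real" where
  "b_squared S = fredholm_det (\<lambda>v. - S (S v)) powr (- 1 / 2)"

text \<open>The statistic \<open>n L\<^sup>2\<close>, as a function of the sample \<open>y 1, \<dots>, y n\<close>.\<close>

definition lmmd_stat :: "('h::real_inner \<Rightarrow> 'h) \<Rightarrow> nat \<Rightarrow> (nat \<Rightarrow> 'h) \<Rightarrow> real" where
  "lmmd_stat S n y =
     1 / (real n - 1) * (\<Sum>(i, j)\<in>{(i, j). i \<in> {1..n} \<and> j \<in> {1..n} \<and> i \<noteq> j}. exp (y i \<bullet> y j))
     - 2 * (\<Sum>i\<in>{1..n}. exp (1 / 2 * (y i \<bullet> S (y i))))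
     + real n * b_squared S"

text \<open>
  The \<open>l\<close>-th smallest entry, counted from 1 and with repetitions.  Beyond the length of the list it is
  infinite: this is needed for the quantile below when \<open>\<alpha> = 1/(B+1)\<close>, where \<open>l = B + 1\<close>.
\<close>

definition order_statistic :: "real list \<Rightarrow> nat \<Rightarrow> ereal" where
  "order_statistic xs l = (if l \<le> length xs then ereal (sort xs ! (l - 1)) else \<infinity>)"

definition mc_quantile :: "real \<Rightarrow> nat \<Rightarrow> (nat \<Rightarrow> real) \<Rightarrow> ereal" where
  "mc_quantile \<alpha> B L =
     order_statistic (map L [1..<Suc B]) (nat \<lfloor>real B + 2 - \<alpha> * (real B + 1)\<rfloor>)"

end

theory Submission
  imports Defs "HOL-Complex_Analysis.Conformal_Mappings" "HOL-Real_Asymp.Real_Asymp"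
begin

text \<open>Under the null hypothesis the statistic and its \<open>B\<close> copies are exchangeable. For every
  realisation at most \<open>B + 1 - \<ell>\<close> of the \<open>B + 1\<close> values have at least \<open>\<ell>\<close> values strictly below
  them, and exactly that many if there are no ties; averaging gives both bounds. Ties are null
  because the law of the statistic has no atoms: condition on everything except \<open>\<langle>Z\<^sub>1, f\<rangle>\<close>, where
  \<open>\<langle>\<Sigma>f, f\<rangle> > 0\<close>. Along the line \<open>Z\<^sub>1 = w + t \<Sigma>f\<close> the statistic is a sum of exponentials of linear
  functions of \<open>t\<close> minus the exponential of a quadratic with positive leading coefficient, hence a
  nonconstant analytic function of \<open>t\<close>, which takes each value only countably often.\<close>

subsection \<open>Ranks and order statistics\<close>

text \<open>The Hilbert space need not be separable, and then even the inner product of two sample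
  points need not be measurable for the product of the Borel sigma-algebras. Hence measurability of
  the statistic goes through pointwise limits of simple functions, and Pettis' theorem recovers such
  limits from scalar measurability on a separable set. The same obstacle shapes the conditioning: a
  Gaussian measure is given only through the laws of single functionals, so the independence of
  \<langle>Z, f\<rangle> from the remainder is proved for the sigma-algebra generated by the
  functionals of the remainder, with no uniqueness theorem beyond Levy's on the real line. The
  direction \<Sigma>f of the line is forced: removing a multiple of it is what leaves a remainder
  uncorrelated with \<langle>Z, f\<rangle>. The gap 1/(B+1) between the two bounds is the rounding
  in \<ell>: by the integer part, B + 1 - \<ell> is at least \<alpha>(B+1) - 1 and less than
  \<alpha>(B+1).\<close>

lemma card_many_below_le:
  fixes x :: "'i \<Rightarrow> real"
  assumes "finite I"
  shows "card {j\<in>I. l \<le> card {b\<in>I. x b < x j}} \<le> card I - l"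
proof (cases "{j\<in>I. l \<le> card {b\<in>I. x b < x j}} = {}")
  case False
  let ?J = "{j\<in>I. l \<le> card {b\<in>I. x b < x j}}"
  from False assms obtain j where j: "j \<in> ?J" "\<forall>i\<in>?J. x j \<le> x i"
    using ex_is_arg_min_if_finite[of ?J x] by (auto simp: is_arg_min_linorder)
  let ?L = "{b\<in>I. x b < x j}"
  \<comment> \<open>\<open>j\<close> has the smallest value in \<open>?J\<close>, so the indices
    strictly below it, at least \<open>l\<close> in number, are all outside
    \<open>?J\<close>.\<close>
  have "?J \<subseteq> I - ?L" using j(2) by force
  then have "card ?J \<le> card (I - ?L)" using assms by (intro card_mono) auto
  also have "\<dots> = card I - card ?L" using assms by (intro card_Diff_subset) auto
  also have "\<dots> \<le> card I - l" using j(1) by auto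
  finally show ?thesis .
qed (metis card.empty le0)

text \<open>Dual argument on the complement \<open>?C\<close>: with distinct values, everything in
  \<open>?C\<close> other than its top index lies strictly below that index, and fewer than
  \<open>l\<close> indices do. A tie at the top would break this count.\<close>

lemma card_many_below_ge:
  fixes x :: "'i \<Rightarrow> real"
  assumes "finite I" and inj: "inj_on x I"
  shows "card I - l \<le> card {j\<in>I. l \<le> card {b\<in>I. x b < x j}}"
proof -
  let ?J = "{j\<in>I. l \<le> card {b\<in>I. x b < x j}}"
  let ?C = "{j\<in>I. card {b\<in>I. x b < x j} < l}"
  have "card ?C \<le> l"
  proof (cases "?C = {}")
    case False
    then obtain j where j: "j \<in> ?C" "\<forall>i\<in>?C. x i \<le> x j"
      using ex_is_arg_min_if_finite[of ?C "\<lambda>i. - x i"] assms by (auto simp: is_arg_min_linorder)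
    have "?C \<subseteq> insert j {b\<in>I. x b < x j}"
      using j inj by (force simp: inj_on_def order_less_le)
    then have "card ?C \<le> card (insert j {b\<in>I. x b < x j})"
      using assms by (intro card_mono) auto
    also have "\<dots> \<le> Suc (card {b\<in>I. x b < x j})" by (rule card_insert_le_m1) auto
    also have "\<dots> \<le> l" using j by auto
    finally show ?thesis .
  qed (metis card.empty le0)
  moreover have "card I = card ?J + card ?C"
    using assms by (subst card_Un_disjoint[symmetric]) (auto intro!: arg_cong[where f=card])
  ultimately show ?thesis by linarith
qed

text \<open>The entries below \<open>c\<close> form an initial segment of the sorted list, so its
  length decides whether index \<open>l - 1\<close> belongs to it. Beyond the end of the list both
  sides are false, the left one because the order statistic is infinite there.\<close>

lemma order_statistic_less_iff:
  assumes "l \<ge> 1"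
  shows "order_statistic xs l < ereal c \<longleftrightarrow> l \<le> card {i. i < length xs \<and> xs ! i < c}"
proof -
  let ?s = "sort xs"
  let ?A = "{i. i < length ?s \<and> ?s ! i < c}"
  have "card {i. i < length xs \<and> xs ! i < c} = length (filter (\<lambda>x. x < c) xs)"
    by (simp add: length_filter_conv_card)
  also have "\<dots> = length (filter (\<lambda>x. x < c) ?s)"
    by (metis mset_filter mset_sort size_mset)
  also have "\<dots> = card ?A"
    by (simp add: length_filter_conv_card)
  finally have eq: "card {i. i < length xs \<and> xs ! i < c} = card ?A" .
  show ?thesis
  proof (cases "l \<le> length xs")
    case False
    have "card ?A \<le> card {..<length xs}" by (intro card_mono) auto
    with False eq show ?thesis by (auto simp: order_statistic_def)
  next
    case True
    have "?s ! (l - 1) < c \<longleftrightarrow> l \<le> card ?A"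
    proof
      assume less: "?s ! (l - 1) < c"
      have "{..<l} \<subseteq> ?A"
      proof
        fix i assume "i \<in> {..<l}"
        then have "i \<le> l - 1" by simp
        then have "?s ! i \<le> ?s ! (l - 1)" using True assms by (intro sorted_nth_mono) auto
        with less \<open>i \<in> {..<l}\<close> True show "i \<in> ?A" by auto
      qed
      from card_mono[OF _ this] show "l \<le> card ?A" by simp
    next
      assume le: "l \<le> card ?A"
      show "?s ! (l - 1) < c"
      proof (rule ccontr)
        assume ge: "\<not> ?s ! (l - 1) < c"
        have "?A \<subseteq> {..<l - 1}"
        proof
          fix i assume "i \<in> ?A"
          have "\<not> l - 1 \<le> i"
          proof
            assume "l - 1 \<le> i"
            then have "?s ! (l - 1) \<le> ?s ! i" using \<open>i \<in> ?A\<close> by (intro sorted_nth_mono) auto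
            with ge \<open>i \<in> ?A\<close> show False by auto
          qed
          then show "i \<in> {..<l - 1}" by auto
        qed
        from card_mono[OF _ this] le assms show False by simp
      qed
    qed
    with True eq show ?thesis by (simp add: order_statistic_def)
  qed
qed

subsection \<open>Random elements\<close>

lemma random_element_borel_measurable:
  "random_element N Y \<Longrightarrow> Y \<in> borel_measurable N"
  unfolding random_element_def
  by (elim exE conjE, rule borel_measurable_LIMSEQ_metric[rotated])
     (auto intro: borel_measurable_simple_function)

lemma random_element_real:
  fixes f :: "'w \<Rightarrow> real"
  assumes "f \<in> borel_measurable N"
  shows "random_element N f"
  using borel_measurable_implies_sequence_metric[OF assms, of 0] by (auto simp: random_element_def)

text \<open>The reason for working with limits of simple functions: two approximating sequences can
  be combined pointwise, so continuous functions of two arguments preserve the class without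
  separability.\<close>

lemma random_element_compose2:
  assumes "random_element N Y" "random_element N Y'"
    and cont: "continuous_on UNIV (\<lambda>p. h (fst p) (snd p))"
  shows "random_element N (\<lambda>\<omega>. h (Y \<omega>) (Y' \<omega>))"
proof -
  obtain s s' where s: "\<And>j::nat. simple_function N (s j)" "\<And>\<omega>. \<omega> \<in> space N \<Longrightarrow> (\<lambda>j. s j \<omega>) \<longlonglongrightarrow> Y \<omega>"
    and s': "\<And>j::nat. simple_function N (s' j)" "\<And>\<omega>. \<omega> \<in> space N \<Longrightarrow> (\<lambda>j. s' j \<omega>) \<longlonglongrightarrow> Y' \<omega>"
    using assms(1,2) unfolding random_element_def by metis
  have "simple_function N (\<lambda>\<omega>. h (s j \<omega>) (s' j \<omega>))" for j
    using s(1) s'(1) by (rule simple_function_compose2)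
  moreover have "(\<lambda>j. h (s j \<omega>) (s' j \<omega>)) \<longlonglongrightarrow> h (Y \<omega>) (Y' \<omega>)" if "\<omega> \<in> space N" for \<omega>
    using continuous_on_tendsto_compose[OF cont tendsto_Pair[OF s(2)[OF that] s'(2)[OF that]]] by simp
  ultimately show ?thesis
    unfolding random_element_def by (intro exI[of _ "\<lambda>j \<omega>. h (s j \<omega>) (s' j \<omega>)"]) auto
qed

lemma random_element_compose:
  assumes "random_element N Y" "T \<in> measurable L N"
  shows "random_element L (\<lambda>\<omega>. Y (T \<omega>))"
proof -
  obtain s where s: "\<And>j::nat. simple_function N (s j)" "\<And>\<omega>. \<omega> \<in> space N \<Longrightarrow> (\<lambda>j. s j \<omega>) \<longlonglongrightarrow> Y \<omega>"
    using assms(1) unfolding random_element_def by metis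
  have "simple_function L (\<lambda>\<omega>. s j (T \<omega>))" for j
  proof (rule simple_function_borel_measurable)
    show "(\<lambda>\<omega>. s j (T \<omega>)) \<in> borel_measurable L"
      by (intro measurable_compose[OF assms(2)] borel_measurable_simple_function s)
    have "(\<lambda>\<omega>. s j (T \<omega>)) ` space L \<subseteq> s j ` space N"
      using measurable_space[OF assms(2)] by auto
    then show "finite ((\<lambda>\<omega>. s j (T \<omega>)) ` space L)"
      using simple_functionD(1)[OF s(1)] finite_subset by blast
  qed
  then show ?thesis
    unfolding random_element_def using s(2) measurable_space[OF assms(2)]
    by (intro exI[of _ "\<lambda>j \<omega>. s j (T \<omega>)"]) auto
qed

lemma random_element_inner:
  fixes Y Y' :: "'w \<Rightarrow> 'h::real_inner"
  assumes "random_element N Y" "random_element N Y'"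
  shows "(\<lambda>\<omega>. Y \<omega> \<bullet> Y' \<omega>) \<in> borel_measurable N"
  by (intro random_element_borel_measurable random_element_compose2[OF assms] continuous_intros)

text \<open>The approximating simple functions take only countably many values altogether; these
  form \<open>D\<close>.\<close>

lemma random_element_separable:
  assumes "random_element N Y"
  obtains D where "countable D" "\<And>\<omega>. \<omega> \<in> space N \<Longrightarrow> Y \<omega> \<in> closure D"
proof -
  obtain s where s: "\<And>j::nat. simple_function N (s j)" "\<And>\<omega>. \<omega> \<in> space N \<Longrightarrow> (\<lambda>j. s j \<omega>) \<longlonglongrightarrow> Y \<omega>"
    using assms(1) unfolding random_element_def by metis
  show ?thesis
  proof
    show "countable (\<Union>j. s j ` space N)"
      using simple_functionD(1)[OF s(1)] by (intro countable_UN) (auto intro: countable_finite)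
    show "Y \<omega> \<in> closure (\<Union>j. s j ` space N)" if "\<omega> \<in> space N" for \<omega>
      unfolding closure_sequential using that s(2)[OF that]
      by (intro exI[of _ "\<lambda>j. s j \<omega>"]) auto
  qed
qed

text \<open>Pettis' theorem. The idea is that on a separable set the norm, and hence the distance to any
  point, is determined by countably many linear functionals; so nearest points in an enumeration of
  the dense set are measurable.\<close>

lemma random_elementI:
  fixes Y :: "'w \<Rightarrow> 'h::real_inner"
  assumes D: "countable D" and Y: "\<And>\<omega>. \<omega> \<in> space N \<Longrightarrow> Y \<omega> \<in> closure D"
    and weak [measurable]: "\<And>g. (\<lambda>\<omega>. Y \<omega> \<bullet> g) \<in> borel_measurable N"
  shows "random_element N Y"
proof (cases "D = {}")
  case True
  then have "space N = {}" using Y by auto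
  then show ?thesis by (auto simp: random_element_def simple_function_def)
next
  case False
  \<comment> \<open>For the converse direction the inequality passes from \<open>D\<close> to its
    closure and is then applied to \<open>Y \<omega>\<close> itself.\<close>
  have norm_le: "norm (Y \<omega>) \<le> a \<longleftrightarrow> 0 \<le> a \<and> (\<forall>d\<in>D. Y \<omega> \<bullet> d \<le> a * norm d)"
    if "\<omega> \<in> space N" for \<omega> a
  proof
    assume le: "norm (Y \<omega>) \<le> a"
    have "Y \<omega> \<bullet> d \<le> a * norm d" for d
      using order_trans[OF norm_cauchy_schwarz mult_right_mono[OF le]] by simp
    with le show "0 \<le> a \<and> (\<forall>d\<in>D. Y \<omega> \<bullet> d \<le> a * norm d)"
      using order_trans[OF norm_ge_zero le] by auto
  next
    assume a: "0 \<le> a \<and> (\<forall>d\<in>D. Y \<omega> \<bullet> d \<le> a * norm d)"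
    have "closed {d. Y \<omega> \<bullet> d \<le> a * norm d}"
      by (intro closed_Collect_le continuous_intros)
    with a have "closure D \<subseteq> {d. Y \<omega> \<bullet> d \<le> a * norm d}"
      by (intro closure_minimal) auto
    with Y[OF that] have "norm (Y \<omega>) * norm (Y \<omega>) \<le> a * norm (Y \<omega>)"
      by (auto simp: dot_square_norm power2_eq_square)
    with a show "norm (Y \<omega>) \<le> a"
      by (cases "Y \<omega> = 0") auto
  qed
  have norm_meas: "(\<lambda>\<omega>. norm (Y \<omega>)) \<in> borel_measurable N"
    unfolding borel_measurable_iff_le
  proof
    fix a
    have "{\<omega> \<in> space N. norm (Y \<omega>) \<le> a} = {\<omega> \<in> space N. 0 \<le> a \<and> (\<forall>d\<in>D. Y \<omega> \<bullet> d \<le> a * norm d)}"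
      using norm_le by auto
    also have "\<dots> \<in> sets N"
      using D by measurable
    finally show "{\<omega> \<in> space N. norm (Y \<omega>) \<le> a} \<in> sets N" .
  qed
  have dist_meas [measurable]: "(\<lambda>\<omega>. dist (Y \<omega>) d) \<in> borel_measurable N" for d
  proof -
    have "dist (Y \<omega>) d = sqrt ((norm (Y \<omega>))\<^sup>2 - 2 * (Y \<omega> \<bullet> d) + d \<bullet> d)" for \<omega>
      by (simp add: dist_norm norm_eq_sqrt_inner inner_diff inner_commute algebra_simps)
    then show ?thesis using norm_meas by simp
  qed
  define d where "d = from_nat_into D"
  have range_d: "range d = D" unfolding d_def using range_from_nat_into[OF False D] .
  \<comment> \<open>Taking the least index among the nearest points resolves ties, so that the
    choice is determined by finitely many comparisons of measurable distances.\<close>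
  define idx where "idx m \<omega> = (LEAST i. i \<le> m \<and> (\<forall>j\<in>{..m}. dist (Y \<omega>) (d i) \<le> dist (Y \<omega>) (d j)))" for m :: nat and \<omega>
  have idx: "idx m \<omega> \<le> m \<and> (\<forall>j\<in>{..m}. dist (Y \<omega>) (d (idx m \<omega>)) \<le> dist (Y \<omega>) (d j))" for m \<omega>
    unfolding idx_def
  proof (rule LeastI_ex)
    show "\<exists>i\<le>m. \<forall>j\<in>{..m}. dist (Y \<omega>) (d i) \<le> dist (Y \<omega>) (d j)"
      using ex_is_arg_min_if_finite[of "{..m}" "\<lambda>i. dist (Y \<omega>) (d i)"]
      by (auto simp: is_arg_min_linorder)
  qed
  have idx_meas: "idx m \<in> measurable N (count_space UNIV)" for m
    unfolding idx_def by measurable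
  have "simple_function N (idx m)" for m
    unfolding simple_function_def
  proof
    show "finite (idx m ` space N)"
      by (rule finite_subset[of _ "{..m}"]) (use idx in auto)
    show "\<forall>x\<in>idx m ` space N. idx m -` {x} \<inter> space N \<in> sets N"
      using measurable_sets[OF idx_meas] by auto
  qed
  then have "simple_function N (\<lambda>\<omega>. d (idx m \<omega>))" for m
    by (rule simple_function_compose1)
  moreover have "(\<lambda>m. d (idx m \<omega>)) \<longlonglongrightarrow> Y \<omega>" if \<omega>: "\<omega> \<in> space N" for \<omega>
  proof (rule metric_LIMSEQ_I)
    fix e :: real assume "0 < e"
    then obtain x where "x \<in> D" "dist x (Y \<omega>) < e"
      using Y[OF \<omega>] by (auto simp: closure_approachable)
    then obtain i where i: "dist (Y \<omega>) (d i) < e"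
      using range_d by (metis dist_commute rangeE)
    have "dist (d (idx m \<omega>)) (Y \<omega>) < e" if "i \<le> m" for m
      using idx[of m \<omega>] i that by (metis atMost_iff dist_commute le_less_trans)
    then show "\<exists>m0. \<forall>m\<ge>m0. dist (d (idx m \<omega>)) (Y \<omega>) < e" by blast
  qed
  ultimately show ?thesis
    unfolding random_element_def by (intro exI[of _ "\<lambda>m \<omega>. d (idx m \<omega>)"]) auto
qed

subsection \<open>Uniqueness of characteristic functions\<close>

text \<open>The positive and negative parts of \<open>u\<close> have the same mass \<open>c\<close>
  (the hypothesis at \<open>s = 0\<close>). Normalised by \<open>c\<close> they are probability
  densities under which \<open>X\<close> has equal characteristic functions, so Levy's theorem
  identifies the two laws of \<open>X\<close>. If \<open>c = 0\<close>, then \<open>u\<close>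
  vanishes almost everywhere.\<close>

lemma integral_mult_indicator_eq_0_real:
  fixes u :: "'a \<Rightarrow> real"
  assumes u: "integrable M u" and X [measurable]: "X \<in> borel_measurable M"
    and eq: "\<And>s. (\<integral>\<omega>. u \<omega> *\<^sub>R iexp (s * X \<omega>) \<partial>M) = 0"
    and A [measurable]: "A \<in> sets borel"
  shows "(\<integral>\<omega>. u \<omega> * indicator A (X \<omega>) \<partial>M) = 0"
proof -
  define up um where "up \<omega> = max 0 (u \<omega>)" and "um \<omega> = max 0 (- u \<omega>)" for \<omega>
  have u_eq: "u \<omega> = up \<omega> - um \<omega>" for \<omega> by (auto simp: up_def um_def)
  have nn: "0 \<le> up \<omega>" "0 \<le> um \<omega>" for \<omega> by (auto simp: up_def um_def)
  have int: "integrable M up" "integrable M um"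
    unfolding up_def um_def using u by auto
  note [measurable] = borel_measurable_integrable[OF int(1)] borel_measurable_integrable[OF int(2)]
  have int_mult: "integrable M (\<lambda>\<omega>. w \<omega> *\<^sub>R h (X \<omega>))"
    if w: "integrable M w" and h [measurable]: "h \<in> borel_measurable borel" and "\<And>x. norm (h x) \<le> 1"
    for w and h :: "real \<Rightarrow> 'c::{banach, second_countable_topology}"
  proof (rule Bochner_Integration.integrable_bound[OF w])
    show "(\<lambda>\<omega>. w \<omega> *\<^sub>R h (X \<omega>)) \<in> borel_measurable M"
      using borel_measurable_integrable[OF w] by measurable
    show "AE \<omega> in M. norm (w \<omega> *\<^sub>R h (X \<omega>)) \<le> norm (w \<omega>)"
      using that(3) by (auto intro!: mult_left_le)
  qed
  have diff: "(\<integral>\<omega>. u \<omega> *\<^sub>R h (X \<omega>) \<partial>M) = (\<integral>\<omega>. up \<omega> *\<^sub>R h (X \<omega>) \<partial>M) - (\<integral>\<omega>. um \<omega> *\<^sub>R h (X \<omega>) \<partial>M)"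
    if "h \<in> borel_measurable borel" "\<And>x. norm (h x) \<le> 1" for h :: "real \<Rightarrow> 'c::{banach, second_countable_topology}"
    unfolding u_eq scaleR_diff_left
    by (intro Bochner_Integration.integral_diff int_mult int that)
  have eq': "(\<integral>\<omega>. up \<omega> *\<^sub>R iexp (s * X \<omega>) \<partial>M) = (\<integral>\<omega>. um \<omega> *\<^sub>R iexp (s * X \<omega>) \<partial>M)" for s
    using eq[of s] by (subst (asm) diff[of "\<lambda>x. iexp (s * x)"]) auto
  define c where "c = (\<integral>\<omega>. up \<omega> \<partial>M)"
  have c: "(\<integral>\<omega>. um \<omega> \<partial>M) = c"
  proof -
    have "complex_of_real (\<integral>\<omega>. um \<omega> \<partial>M) = complex_of_real c"
      using eq'[of 0] unfolding c_def integral_complex_of_real[symmetric] by (simp add: scaleR_conv_of_real)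
    then show ?thesis by simp
  qed
  show ?thesis
  proof (cases "c = 0")
    case True
    then have "AE \<omega> in M. up \<omega> = 0"
      using nn int by (simp add: c_def integral_nonneg_eq_0_iff_AE)
    moreover have "AE \<omega> in M. um \<omega> = 0"
      using True c nn int by (simp add: integral_nonneg_eq_0_iff_AE[symmetric])
    ultimately have "AE \<omega> in M. u \<omega> * indicator A (X \<omega>) = 0"
      by eventually_elim (simp add: u_eq)
    then show ?thesis by (rule integral_eq_zero_AE)
  next
    case False
    have "c \<ge> 0" unfolding c_def using nn by simp
    with False have "c > 0" by simp
    define N where "N w = distr (density M (\<lambda>\<omega>. ennreal (w \<omega> / c))) borel X" for w :: "'a \<Rightarrow> real"
    have N: "real_distribution (N w)"
      and N_int: "\<And>h :: real \<Rightarrow> complex. h \<in> borel_measurable borel \<Longrightarrow>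
          (\<integral>x. h x \<partial>N w) = (\<integral>\<omega>. w \<omega> *\<^sub>R h (X \<omega>) \<partial>M) /\<^sub>R c"
      and N_meas: "measure (N w) A = (\<integral>\<omega>. w \<omega> * indicator A (X \<omega>) \<partial>M) / c"
      if w: "integrable M w" "\<And>\<omega>. 0 \<le> w \<omega>" "(\<integral>\<omega>. w \<omega> \<partial>M) = c" for w
    proof -
      note [measurable] = borel_measurable_integrable[OF w(1)]
      have "(\<integral>\<^sup>+\<omega>. ennreal (w \<omega> / c) \<partial>M) = ennreal (\<integral>\<omega>. w \<omega> / c \<partial>M)"
        using w \<open>c > 0\<close> by (intro nn_integral_eq_integral) auto
      also have "\<dots> = 1" using w \<open>c > 0\<close> by simp
      finally have "prob_space (density M (\<lambda>\<omega>. ennreal (w \<omega> / c)))"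
        by (intro prob_spaceI) (simp add: emeasure_density cong: nn_integral_cong)
      then interpret D: prob_space "density M (\<lambda>\<omega>. ennreal (w \<omega> / c))" .
      show rd: "real_distribution (N w)"
        unfolding N_def by (intro D.real_distribution_distr) simp
      show h: "(\<integral>x. h x \<partial>N w) = (\<integral>\<omega>. w \<omega> *\<^sub>R h (X \<omega>) \<partial>M) /\<^sub>R c"
        if [measurable]: "h \<in> borel_measurable borel" for h :: "real \<Rightarrow> complex"
      proof -
        have "(\<integral>x. h x \<partial>N w) = (\<integral>\<omega>. (w \<omega> / c) *\<^sub>R h (X \<omega>) \<partial>M)"
          unfolding N_def using w \<open>c > 0\<close>
          by (subst integral_distr, simp, simp, subst integral_density) auto
        also have "\<dots> = (\<integral>\<omega>. inverse c *\<^sub>R (w \<omega> *\<^sub>R h (X \<omega>)) \<partial>M)"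
          by (simp add: divide_inverse mult.commute)
        finally show ?thesis by (simp only: integral_scaleR_right)
      qed
      interpret R: real_distribution "N w" by fact
      have "measure (N w) A = (\<integral>x. indicat_real A x \<partial>N w)" by simp
      also have "\<dots> = (\<integral>\<omega>. (w \<omega> / c) *\<^sub>R indicat_real A (X \<omega>) \<partial>M)"
        unfolding N_def using w \<open>c > 0\<close>
        by (subst integral_distr, simp, simp, subst integral_density) auto
      finally show "measure (N w) A = (\<integral>\<omega>. w \<omega> * indicator A (X \<omega>) \<partial>M) / c" by simp
    qed
    have up: "integrable M up" "\<And>\<omega>. 0 \<le> up \<omega>" "(\<integral>\<omega>. up \<omega> \<partial>M) = c"
      and um: "integrable M um" "\<And>\<omega>. 0 \<le> um \<omega>" "(\<integral>\<omega>. um \<omega> \<partial>M) = c"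
      using int nn c by (auto simp: c_def)
    have "char (N up) = char (N um)"
      unfolding char_def using eq' by (simp add: fun_eq_iff N_int[OF up] N_int[OF um])
    then have "N up = N um"
      by (intro Levy_uniqueness N up um)
    then have "(\<integral>\<omega>. up \<omega> * indicator A (X \<omega>) \<partial>M) = (\<integral>\<omega>. um \<omega> * indicator A (X \<omega>) \<partial>M)"
      using N_meas[OF up] N_meas[OF um] False by simp
    then show ?thesis using diff[of "indicat_real A"] by simp
  qed
qed

text \<open>The hypothesis holds for all real \<open>s\<close>, and conjugation exchanges
  \<open>s\<close> and \<open>- s\<close>. It therefore passes from \<open>u\<close> to
  \<open>cnj u\<close>, hence to the real and imaginary parts, where the real case applies.\<close>

lemma integral_mult_indicator_eq_0:
  fixes u :: "'a \<Rightarrow> complex"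
  assumes u: "integrable M u" and X [measurable]: "X \<in> borel_measurable M"
    and eq: "\<And>s. (\<integral>\<omega>. u \<omega> * iexp (s * X \<omega>) \<partial>M) = 0"
    and A [measurable]: "A \<in> sets borel"
  shows "(\<integral>\<omega>. u \<omega> * indicator A (X \<omega>) \<partial>M) = 0"
proof -
  note [measurable] = borel_measurable_integrable[OF u]
  have int: "integrable M (\<lambda>\<omega>. u \<omega> * iexp (s * X \<omega>))" for s
    by (rule Bochner_Integration.integrable_bound[OF u]) (auto simp: norm_mult)
  have eq_cnj: "(\<integral>\<omega>. cnj (u \<omega>) * iexp (s * X \<omega>) \<partial>M) = 0" for s
  proof -
    have "(\<integral>\<omega>. cnj (u \<omega>) * iexp (s * X \<omega>) \<partial>M) = (\<integral>\<omega>. cnj (u \<omega> * iexp ((- s) * X \<omega>)) \<partial>M)"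
      by (simp add: exp_cnj)
    also have "\<dots> = 0" unfolding Bochner_Integration.integral_cnj eq by simp
    finally show ?thesis .
  qed
  have int_cnj: "integrable M (\<lambda>\<omega>. cnj (u \<omega>) * iexp (s * X \<omega>))" for s
  proof -
    have "integrable M (\<lambda>\<omega>. cnj (u \<omega> * iexp ((- s) * X \<omega>)))"
      using int by (simp only: integrable_cnj)
    then show ?thesis by (simp add: exp_cnj)
  qed
  have "(\<integral>\<omega>. Re (u \<omega>) *\<^sub>R iexp (s * X \<omega>) \<partial>M) = 0" for s
  proof -
    have "(\<integral>\<omega>. Re (u \<omega>) *\<^sub>R iexp (s * X \<omega>) \<partial>M)
        = (\<integral>\<omega>. (u \<omega> * iexp (s * X \<omega>) + cnj (u \<omega>) * iexp (s * X \<omega>)) / 2 \<partial>M)"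
      by (simp add: scaleR_conv_of_real distrib_right[symmetric] complex_add_cnj)
    also have "\<dots> = 0" using int int_cnj eq eq_cnj by simp
    finally show ?thesis .
  qed
  then have Re: "(\<integral>\<omega>. Re (u \<omega>) * indicator A (X \<omega>) \<partial>M) = 0"
    using u by (intro integral_mult_indicator_eq_0_real) auto
  have "(\<integral>\<omega>. Im (u \<omega>) *\<^sub>R iexp (s * X \<omega>) \<partial>M) = 0" for s
  proof -
    have "(\<integral>\<omega>. Im (u \<omega>) *\<^sub>R iexp (s * X \<omega>) \<partial>M)
        = (\<integral>\<omega>. (u \<omega> * iexp (s * X \<omega>) - cnj (u \<omega>) * iexp (s * X \<omega>)) / (2 * \<i>) \<partial>M)"
    proof (rule Bochner_Integration.integral_cong)
      show "Im (u \<omega>) *\<^sub>R iexp (s * X \<omega>)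
          = (u \<omega> * iexp (s * X \<omega>) - cnj (u \<omega>) * iexp (s * X \<omega>)) / (2 * \<i>)" for \<omega>
        by (subst left_diff_distrib[symmetric], subst complex_diff_cnj) (simp add: scaleR_conv_of_real mult_ac)
    qed simp
    also have "\<dots> = 0" using int int_cnj eq eq_cnj by simp
    finally show ?thesis .
  qed
  then have Im: "(\<integral>\<omega>. Im (u \<omega>) * indicator A (X \<omega>) \<partial>M) = 0"
    using u by (intro integral_mult_indicator_eq_0_real) auto
  have int_ind: "integrable M (\<lambda>\<omega>. u \<omega> * indicator A (X \<omega>))"
    by (rule Bochner_Integration.integrable_bound[OF u]) (auto simp: norm_mult indicator_def)
  have 1: "Re (u \<omega> * indicator A (X \<omega>)) = Re (u \<omega>) * indicator A (X \<omega>)"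
    "Im (u \<omega> * indicator A (X \<omega>)) = Im (u \<omega>) * indicator A (X \<omega>)" for \<omega>
    by (auto simp: indicator_def)
  show ?thesis
    by (rule complex_eqI)
       (use Re Im in \<open>simp_all only: integral_Re[OF int_ind, symmetric] integral_Im[OF int_ind, symmetric] 1 zero_complex.sel\<close>)
qed

text \<open>A substitute for multivariate uniqueness: one exponential factor at a time is exchanged
  for an indicator by the one-dimensional result. This is why \<open>u\<close> is an arbitrary
  integrable weight, able to absorb the other factors.\<close>

lemma integral_mult_prod_indicator_eq_0:
  fixes u :: "'a \<Rightarrow> complex" and X :: "'i \<Rightarrow> 'a \<Rightarrow> real"
  assumes "finite I" and "integrable M u" and X: "\<And>i. X i \<in> borel_measurable M"
    and "\<And>s. (\<integral>\<omega>. u \<omega> * iexp (\<Sum>i\<in>I. s i * X i \<omega>) \<partial>M) = 0"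
    and A: "\<And>i. A i \<in> sets borel"
  shows "(\<integral>\<omega>. u \<omega> * (\<Prod>i\<in>I. indicator (A i) (X i \<omega>)) \<partial>M) = 0"
  using assms(1,2,4)
proof (induction I arbitrary: u rule: finite_induct)
  case empty
  then show ?case by simp
next
  case (insert j I)
  note u = insert.prems(1)
  note [measurable] = borel_measurable_integrable[OF u] X A
  let ?u = "\<lambda>\<omega>. u \<omega> * indicator (A j) (X j \<omega>)"
  have int: "integrable M ?u"
    by (rule Bochner_Integration.integrable_bound[OF u]) (auto simp: norm_mult indicator_def)
  have "(\<integral>\<omega>. ?u \<omega> * (\<Prod>i\<in>I. indicator (A i) (X i \<omega>)) \<partial>M) = 0"
  proof (rule insert.IH[OF int])
    fix s :: "'i \<Rightarrow> real"
    \<comment> \<open>The exponentials not yet exchanged become part of the weight, leaving a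
      statement about \<open>X j\<close> alone.\<close>
    let ?v = "\<lambda>\<omega>. u \<omega> * iexp (\<Sum>i\<in>I. s i * X i \<omega>)"
    have "(\<integral>\<omega>. ?v \<omega> * indicator (A j) (X j \<omega>) \<partial>M) = 0"
    proof (rule integral_mult_indicator_eq_0)
      show "integrable M ?v"
        by (rule Bochner_Integration.integrable_bound[OF u]) (auto simp: norm_mult)
      show "(\<integral>\<omega>. ?v \<omega> * iexp (r * X j \<omega>) \<partial>M) = 0" for r
      proof -
        have "(\<Sum>i\<in>I. (s(j := r)) i * X i \<omega>) = (\<Sum>i\<in>I. s i * X i \<omega>)" for \<omega>
          using insert.hyps by (intro sum.cong) auto
        then have sum: "(\<Sum>i\<in>insert j I. (s(j := r)) i * X i \<omega>) = r * X j \<omega> + (\<Sum>i\<in>I. s i * X i \<omega>)" for \<omega>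
          by (subst sum.insert[OF insert.hyps]) (simp only: fun_upd_same)
        have "?v \<omega> * iexp (r * X j \<omega>) = u \<omega> * iexp (\<Sum>i\<in>insert j I. (s(j := r)) i * X i \<omega>)" for \<omega>
          unfolding sum of_real_add distrib_left exp_add by (simp only: mult_ac)
        then show ?thesis
          by (simp only: insert.prems(2))
      qed
    qed auto
    then show "(\<integral>\<omega>. ?u \<omega> * iexp (\<Sum>i\<in>I. s i * X i \<omega>) \<partial>M) = 0"
      by (simp add: mult_ac)
  qed
  then show ?case using insert.hyps by (simp add: mult.assoc)
qed

subsection \<open>Gaussian measures\<close>

text \<open>Writing the exponent with the variance \<open>cov M U U\<close> treats the Dirac measure
  and the nondegenerate case alike.\<close>

lemma centered_gaussian_char:
  assumes "prob_space M" and U [measurable]: "U \<in> borel_measurable M"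
    and gauss: "centered_gaussian (distr M borel U)"
  shows "(\<integral>\<omega>. iexp (U \<omega>) \<partial>M) = exp (- (cov M U U / 2))"
proof -
  interpret prob_space M by fact
  have transfer: "(\<integral>\<omega>. h (U \<omega>) \<partial>M) = (\<integral>x. h x \<partial>distr M borel U)"
    if "h \<in> borel_measurable borel" for h :: "real \<Rightarrow> 'c::{banach, second_countable_topology}"
    using that by (simp add: integral_distr)
  from gauss consider "distr M borel U = return borel 0"
    | \<sigma> where "\<sigma> > 0" "distr M borel U = density lborel (\<lambda>x. ennreal (normal_density 0 \<sigma> x))"
    unfolding centered_gaussian_def by blast
  then show ?thesis
  proof cases
    case 1
    have "expectation U = 0"
      using transfer[of "\<lambda>x. x"] by (simp add: 1 integral_return)
    moreover have "(\<integral>\<omega>. U \<omega> * U \<omega> \<partial>M) = 0"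
      using transfer[of "\<lambda>x. x * x"] by (simp add: 1 integral_return)
    ultimately have "cov M U U = 0" by (simp add: cov_def)
    then show ?thesis using transfer[of "\<lambda>x. iexp x"] by (simp add: 1 integral_return)
  next
    case 2
    have "distr M lborel U = distr M borel U" by (rule distr_cong) auto
    with 2 have D: "distributed M lborel U (normal_density 0 \<sigma>)"
      by (simp add: distributed_def)
    have var: "cov M U U = \<sigma>\<^sup>2"
      using normal_distributed_variance[OF 2(1) D] by (simp add: cov_def power2_eq_square)
    from D have "distributed M lborel (\<lambda>\<omega>. U \<omega> / \<sigma>) std_normal_density"
      using normal_standard_normal_convert[OF 2(1), of U 0] by simp
    then have std: "distr M borel (\<lambda>\<omega>. U \<omega> / \<sigma>) = std_normal_distribution"
      using distr_cong[of M M lborel borel "\<lambda>\<omega>. U \<omega> / \<sigma>"] by (simp add: distributed_def)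
    have "(\<integral>\<omega>. iexp (U \<omega>) \<partial>M) = (\<integral>\<omega>. iexp (\<sigma> * (U \<omega> / \<sigma>)) \<partial>M)"
      using 2 by simp
    also have "\<dots> = char std_normal_distribution \<sigma>"
      unfolding std[symmetric] char_def by (subst integral_distr) auto
    finally show ?thesis
      by (simp add: char_std_normal_distribution var exp_of_real)
  qed
qed

lemma emeasure_centered_gaussian_countable:
  assumes "centered_gaussian \<mu>" "\<mu> \<noteq> return borel 0" "countable A"
  shows "emeasure \<mu> A = 0"
proof -
  obtain \<sigma> where "\<mu> = density lborel (\<lambda>x. ennreal (normal_density 0 \<sigma> x))"
    using assms by (auto simp: centered_gaussian_def)
  moreover have "A \<in> null_sets lborel"
    using assms countable_imp_null_set_lborel by blast
  ultimately show ?thesis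
    using absolutely_continuousI_density[of "\<lambda>x. ennreal (normal_density 0 \<sigma> x)" lborel]
    by (auto simp: absolutely_continuous_def null_sets_def)
qed

lemma gaussian_random_element_inner:
  fixes Z :: "'w \<Rightarrow> 'h::{real_inner,banach}"
  assumes P: "gaussian_measure P S" and "prob_space M"
    and Z: "Z \<in> borel_measurable M" and distr: "distr M borel Z = P"
  shows gaussian_inner: "centered_gaussian (distr M borel (\<lambda>\<omega>. Z \<omega> \<bullet> f))"
    and gaussian_inner_cov: "cov M (\<lambda>\<omega>. Z \<omega> \<bullet> f) (\<lambda>\<omega>. Z \<omega> \<bullet> g) = S f \<bullet> g"
    and gaussian_inner_char: "(\<integral>\<omega>. iexp (Z \<omega> \<bullet> f) \<partial>M) = exp (- (S f \<bullet> f / 2))"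
proof -
  have [measurable]: "(\<lambda>z. z \<bullet> g) \<in> borel_measurable borel" for g :: 'h
    by (intro borel_measurable_continuous_onI continuous_intros)
  note [measurable] = Z
  have "distr M borel (\<lambda>\<omega>. Z \<omega> \<bullet> f) = distr P borel (\<lambda>z. z \<bullet> f)"
    unfolding distr[symmetric] by (simp add: distr_distr comp_def)
  then show cg: "centered_gaussian (distr M borel (\<lambda>\<omega>. Z \<omega> \<bullet> f))"
    using P by (simp add: gaussian_measure_def)
  have "cov M (\<lambda>\<omega>. Z \<omega> \<bullet> f) (\<lambda>\<omega>. Z \<omega> \<bullet> g) = cov P (\<lambda>z. z \<bullet> f) (\<lambda>z. z \<bullet> g)" for f g
    unfolding distr[symmetric] cov_def by (simp add: integral_distr)
  then show *: "cov M (\<lambda>\<omega>. Z \<omega> \<bullet> f) (\<lambda>\<omega>. Z \<omega> \<bullet> g) = S f \<bullet> g" for f g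
    using P by (simp add: gaussian_measure_def)
  show "(\<integral>\<omega>. iexp (Z \<omega> \<bullet> f) \<partial>M) = exp (- (S f \<bullet> f / 2))"
    using centered_gaussian_char[OF assms(2) _ cg] by (simp add: *)
qed

lemma gaussian_measure_symmetric:
  assumes "gaussian_measure P S"
  shows "S f \<bullet> g = S g \<bullet> f"
  using assms by (simp add: gaussian_measure_def cov_def mult.commute)

lemma gaussian_measure_nonneg:
  assumes "gaussian_measure P S"
  shows "0 \<le> S f \<bullet> f"
  using assms by (simp add: gaussian_measure_def cov_def)

text \<open>The nonnegative quadratic form of \<open>S\<close> has a minimum at \<open>f\<close>, so
  its first variation in the direction \<open>S f\<close>, which is 2
  \<open>(S f \<bullet> S f)\<close>, must vanish.\<close>

lemma gaussian_measure_kernel: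
  assumes P: "gaussian_measure P S" and f: "S f \<bullet> f = 0"
  shows "S f = 0"
proof (rule ccontr)
  assume ne: "S f \<noteq> 0"
  interpret S: bounded_linear S using P by (simp add: gaussian_measure_def)
  define a where "a = S f \<bullet> S f"
  define c where "c = S (S f) \<bullet> S f"
  have a: "a > 0" using ne by (simp add: a_def)
  have c: "c \<ge> 0" unfolding c_def by (rule gaussian_measure_nonneg[OF P])
  \<comment> \<open>The parabola \<open>2 * t * a + t\<^sup>2 * c\<close> would be least at
    \<open>- a / c\<close>; adding 1 to the denominator covers \<open>c = 0\<close> and keeps the
    value negative.\<close>
  define t where "t = - a / (c + 1)"
  have "0 \<le> S (f + t *\<^sub>R S f) \<bullet> (f + t *\<^sub>R S f)" by (rule gaussian_measure_nonneg[OF P])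
  also have "\<dots> = 2 * t * a + t\<^sup>2 * c"
    using gaussian_measure_symmetric[OF P, of f "S f"] f
    by (simp add: S.add S.scaleR inner_add inner_commute a_def c_def power2_eq_square algebra_simps)
  also have "\<dots> = t * (2 * a + t * c)" by (simp add: power2_eq_square algebra_simps)
  also have "\<dots> < 0"
  proof (rule mult_neg_pos)
    show "t < 0" using a c by (simp add: t_def divide_neg_pos)
    have "a * c / (c + 1) < a + a" using a c by (simp add: field_simps add_nonneg_pos)
    then show "0 < 2 * a + t * c" by (simp add: t_def)
  qed
  finally show False by simp
qed

text \<open>Decompose \<open>Z = \<langle>Z, f\<rangle> v + W\<close> with \<open>v = S f / \<langle>S f, f\<rangle>\<close>. Then \<open>W\<close> is uncorrelated with, and so
  independent of, the nondegenerate Gaussian variable \<open>\<langle>Z, f\<rangle>\<close>.\<close>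

lemma gaussian_null_set:
  fixes Z :: "'w \<Rightarrow> 'h::{real_inner,banach}"
  assumes P: "gaussian_measure P S" and M: "prob_space M"
    and Z: "random_element M Z" and distr: "distr M borel Z = P"
    and f: "S f \<bullet> f > 0"
    and A [measurable]: "A \<in> sets borel" and lines: "\<And>w. countable {t. w + t *\<^sub>R S f \<in> A}"
  shows "emeasure M {\<omega>\<in>space M. Z \<omega> \<in> A} = 0"
proof -
  interpret prob_space M by fact
  interpret S: bounded_linear S using P by (simp add: gaussian_measure_def)
  note Z_meas [measurable] = random_element_borel_measurable[OF Z]
  have inner_meas: "(\<lambda>z. z \<bullet> g) \<in> borel_measurable borel" for g :: 'h
    by (intro borel_measurable_continuous_onI continuous_intros)
  note [measurable] = measurable_compose[OF Z_meas inner_meas]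
  define q where "q = S f \<bullet> f"
  define v where "v = S f /\<^sub>R q"
  define \<xi> where "\<xi> \<omega> = Z \<omega> \<bullet> f" for \<omega>
  define W where "W \<omega> = Z \<omega> - \<xi> \<omega> *\<^sub>R v" for \<omega>
  have q: "q > 0" using f by (simp add: q_def)
  have \<xi> [measurable]: "\<xi> \<in> borel_measurable M" unfolding \<xi>_def by measurable
  have W: "random_element M W"
    unfolding W_def
    by (rule random_element_compose2[OF Z random_element_real[OF \<xi>]]) (intro continuous_intros)
  note [measurable] = measurable_compose[OF random_element_borel_measurable[OF W] inner_meas]
  \<comment> \<open>Every combination of \<open>W\<close> and \<open>\<xi>\<close> is again a single
    functional of \<open>Z\<close>, so its characteristic function is known without any joint
    Gaussian law being assumed.\<close>
  have WZ: "W \<omega> \<bullet> g + s * \<xi> \<omega> = Z \<omega> \<bullet> (g - (v \<bullet> g) *\<^sub>R f + s *\<^sub>R f)" for \<omega> g s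
    by (simp add: W_def \<xi>_def algebra_simps inner_add inner_diff)
  have char: "(\<integral>\<omega>. iexp (W \<omega> \<bullet> g + s * \<xi> \<omega>) \<partial>M)
      = (\<integral>\<omega>. iexp (W \<omega> \<bullet> g) \<partial>M) * (\<integral>\<omega>. iexp (s * \<xi> \<omega>) \<partial>M)" for g s
  proof -
    define g' where "g' = g - (v \<bullet> g) *\<^sub>R f"
    \<comment> \<open>This is the uncorrelatedness: the factor 1 / \<open>q\<close> in
      \<open>v\<close> makes \<open>v \<bullet> f = 1\<close>. The cross terms of the quadratic form
      vanish, and its exponential factorises.\<close>
    have "S f \<bullet> g' = 0"
      using q by (simp add: g'_def v_def inner_diff q_def[symmetric])
    moreover have "S g' \<bullet> f = S f \<bullet> g'" by (rule gaussian_measure_symmetric[OF P])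
    ultimately have eq: "S (g' + s *\<^sub>R f) \<bullet> (g' + s *\<^sub>R f) = S g' \<bullet> g' + S (s *\<^sub>R f) \<bullet> (s *\<^sub>R f)"
      by (simp add: S.add S.scaleR inner_add)
    have "(\<integral>\<omega>. iexp (W \<omega> \<bullet> g + s * \<xi> \<omega>) \<partial>M) = (\<integral>\<omega>. iexp (Z \<omega> \<bullet> (g' + s *\<^sub>R f)) \<partial>M)"
      by (simp add: WZ g'_def)
    also have "\<dots> = complex_of_real (exp (- (S g' \<bullet> g' / 2)))
        * complex_of_real (exp (- (S (s *\<^sub>R f) \<bullet> (s *\<^sub>R f) / 2)))"
      by (simp only: gaussian_inner_char[OF P M Z_meas distr] eq of_real_mult[symmetric]
          exp_add[symmetric] minus_add_distrib[symmetric] add_divide_distrib)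
    also have "\<dots> = (\<integral>\<omega>. iexp (Z \<omega> \<bullet> g') \<partial>M) * (\<integral>\<omega>. iexp (Z \<omega> \<bullet> (s *\<^sub>R f)) \<partial>M)"
      by (simp only: gaussian_inner_char[OF P M Z_meas distr])
    also have "\<dots> = (\<integral>\<omega>. iexp (W \<omega> \<bullet> g) \<partial>M) * (\<integral>\<omega>. iexp (s * \<xi> \<omega>) \<partial>M)"
      using WZ[of _ g 0] by (simp add: g'_def \<xi>_def)
    finally show ?thesis .
  qed
  have int: "integrable M (\<lambda>\<omega>. iexp (U \<omega>))" if "U \<in> borel_measurable M" for U
    by (rule integrable_iexp) (use that in auto)
  have int_bdd: "integrable M h" if "h \<in> borel_measurable M" "\<And>\<omega>. norm (h \<omega>) \<le> c" for h :: "'w \<Rightarrow> complex" and c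
    using that by (intro integrable_const_bound[where B=c]) auto
  have char_indicator: "(\<integral>\<omega>. iexp (W \<omega> \<bullet> g) * indicator B (\<xi> \<omega>) \<partial>M)
      = (\<integral>\<omega>. iexp (W \<omega> \<bullet> g) \<partial>M) * (\<integral>\<omega>. indicator B (\<xi> \<omega>) \<partial>M)"
    if [measurable]: "B \<in> sets borel" for g B
  proof -
    define c where "c = (\<integral>\<omega>. iexp (W \<omega> \<bullet> g) \<partial>M)"
    have intB: "integrable M (\<lambda>\<omega>. indicator B (\<xi> \<omega>) :: complex)"
      "integrable M (\<lambda>\<omega>. iexp (W \<omega> \<bullet> g) * indicator B (\<xi> \<omega>))"
      by (auto intro!: int_bdd[of _ 1] simp: indicator_def norm_mult)
    \<comment> \<open>Subtracting the mean \<open>c\<close> turns a factorisation into a vanishing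
      integral, the form that the uniqueness lemma handles.\<close>
    have "(\<integral>\<omega>. (iexp (W \<omega> \<bullet> g) - c) * indicator B (\<xi> \<omega>) \<partial>M) = 0"
    proof (rule integral_mult_indicator_eq_0)
      show "integrable M (\<lambda>\<omega>. iexp (W \<omega> \<bullet> g) - c)" using int by simp
      show "(\<integral>\<omega>. (iexp (W \<omega> \<bullet> g) - c) * iexp (s * \<xi> \<omega>) \<partial>M) = 0" for s
      proof -
        have int1: "integrable M (\<lambda>\<omega>. iexp (W \<omega> \<bullet> g + s * \<xi> \<omega>))" by (rule int) measurable
        have int2: "integrable M (\<lambda>\<omega>. c * iexp (s * \<xi> \<omega>))"
          by (intro integrable_mult_right int) measurable
        have "(\<integral>\<omega>. (iexp (W \<omega> \<bullet> g) - c) * iexp (s * \<xi> \<omega>) \<partial>M)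
            = (\<integral>\<omega>. iexp (W \<omega> \<bullet> g + s * \<xi> \<omega>) - c * iexp (s * \<xi> \<omega>) \<partial>M)"
          by (simp add: algebra_simps exp_add)
        also have "\<dots> = 0"
          by (subst Bochner_Integration.integral_diff[OF int1 int2])
             (simp only: char c_def integral_mult_right_zero diff_self)
        finally show ?thesis .
      qed
    qed auto
    then show ?thesis
      using intB by (simp add: left_diff_distrib c_def)
  qed
  have cylinder: "prob ({\<omega>\<in>space M. \<xi> \<omega> \<in> B} \<inter> {\<omega>\<in>space M. \<forall>g\<in>I. W \<omega> \<bullet> g \<in> C g})
      = prob {\<omega>\<in>space M. \<xi> \<omega> \<in> B} * prob {\<omega>\<in>space M. \<forall>g\<in>I. W \<omega> \<bullet> g \<in> C g}"
    if [measurable]: "B \<in> sets borel" and I [measurable]: "finite I" and C [measurable]: "\<And>g. C g \<in> sets borel" for B I C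
  proof -
    define b where "b = prob {\<omega>\<in>space M. \<xi> \<omega> \<in> B}"
    let ?E = "{\<omega>\<in>space M. \<forall>g\<in>I. W \<omega> \<bullet> g \<in> C g}"
    have ind: "(\<integral>\<omega>. indicator F \<omega> \<partial>M) = complex_of_real (prob F)" if "F \<in> sets M" for F
    proof -
      have "(\<integral>\<omega>. indicator F \<omega> \<partial>M) = (\<integral>\<omega>. complex_of_real (indicat_real F \<omega>) \<partial>M)"
        by (intro Bochner_Integration.integral_cong) (auto simp: indicator_def)
      also have "\<dots> = complex_of_real (prob F)"
        using that by (simp only: integral_complex_of_real) (simp add: sets.Int_space_eq1)
      finally show ?thesis .
    qed
    have b: "(\<integral>\<omega>. indicator B (\<xi> \<omega>) \<partial>M) = complex_of_real b"
      unfolding b_def by (subst ind[symmetric]) (auto intro!: Bochner_Integration.integral_cong simp: indicator_def)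
    \<comment> \<open>The same centring with the roles exchanged: \<open>char_indicator\<close>
      makes \<open>?u\<close> orthogonal to every \<open>iexp (W \<omega> \<bullet> h)\<close>, and
      a linear combination of functionals of \<open>W\<close> is one such functional.\<close>
    let ?u = "\<lambda>\<omega>. indicator B (\<xi> \<omega>) - complex_of_real b"
    have intu: "integrable M ?u"
      by (intro int_bdd[of _ "1 + norm (complex_of_real b)"])
         (auto simp: indicator_def intro: order_trans[OF norm_triangle_ineq4])
    have "(\<integral>\<omega>. ?u \<omega> * (\<Prod>g\<in>I. indicator (C g) (W \<omega> \<bullet> g)) \<partial>M) = 0"
    proof (rule integral_mult_prod_indicator_eq_0[OF I intu])
      fix s :: "'h \<Rightarrow> real"
      have "(\<Sum>g\<in>I. s g * (W \<omega> \<bullet> g)) = W \<omega> \<bullet> (\<Sum>g\<in>I. s g *\<^sub>R g)" for \<omega>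
        by (simp add: inner_sum_right)
      moreover have "(\<integral>\<omega>. ?u \<omega> * iexp (W \<omega> \<bullet> h) \<partial>M) = 0" for h
      proof -
        have "integrable M (\<lambda>\<omega>. iexp (W \<omega> \<bullet> h) * indicator B (\<xi> \<omega>))"
          by (auto intro!: int_bdd[of _ 1] simp: indicator_def norm_mult)
        then show ?thesis
          using char_indicator[of B h] b int[of "\<lambda>\<omega>. W \<omega> \<bullet> h"] by (simp add: left_diff_distrib mult.commute)
      qed
      ultimately show "(\<integral>\<omega>. ?u \<omega> * iexp (\<Sum>g\<in>I. s g * (W \<omega> \<bullet> g)) \<partial>M) = 0" by simp
    qed auto
    also have "(\<integral>\<omega>. ?u \<omega> * (\<Prod>g\<in>I. indicator (C g) (W \<omega> \<bullet> g)) \<partial>M)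
        = (\<integral>\<omega>. indicator ({\<omega>\<in>space M. \<xi> \<omega> \<in> B} \<inter> ?E) \<omega> - of_real b * indicator ?E \<omega> \<partial>M)"
    proof (rule Bochner_Integration.integral_cong)
      fix \<omega> assume \<omega>: "\<omega> \<in> space M"
      have "(\<Prod>g\<in>I. indicator (C g) (W \<omega> \<bullet> g)) = (if \<forall>g\<in>I. W \<omega> \<bullet> g \<in> C g then 1 else (0::complex))"
        using I by (auto simp: indicator_def intro!: prod.neutral)
      then show "?u \<omega> * (\<Prod>g\<in>I. indicator (C g) (W \<omega> \<bullet> g))
          = indicator ({\<omega>\<in>space M. \<xi> \<omega> \<in> B} \<inter> ?E) \<omega> - of_real b * indicator ?E \<omega>"
        using \<omega> by (auto simp: indicator_def)
    qed simp
    also have "\<dots> = complex_of_real (prob ({\<omega>\<in>space M. \<xi> \<omega> \<in> B} \<inter> ?E) - b * prob ?E)"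
    proof -
      have E: "?E \<in> sets M" and BE: "{\<omega>\<in>space M. \<xi> \<omega> \<in> B} \<inter> ?E \<in> sets M" by measurable
      have int_ind: "integrable M (indicator F :: 'w \<Rightarrow> complex)" if "F \<in> sets M" for F
        using that by (intro int_bdd[of _ 1]) (auto simp: indicator_def)
      show ?thesis
        by (simp only: Bochner_Integration.integral_diff[OF int_ind[OF BE] integrable_mult_right[OF int_ind[OF E]]]
            integral_mult_right_zero ind[OF E] ind[OF BE] of_real_diff of_real_mult)
    qed
    finally have "complex_of_real (prob ({\<omega>\<in>space M. \<xi> \<omega> \<in> B} \<inter> ?E) - b * prob ?E) = 0" .
    then show ?thesis unfolding of_real_eq_0_iff b_def by simp
  qed
  \<comment> \<open>Independence is known only for cylinder sets of \<open>W\<close>, which need not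
    generate the Borel sigma-algebra. The second factor of the product is therefore the sample space
    itself with the sigma-algebra \<open>N\<close> generated by these cylinders.\<close>
  define \<E> where "\<E> = {{\<omega>\<in>space M. \<forall>g\<in>I. W \<omega> \<bullet> g \<in> C g} | I C. finite I \<and> (\<forall>g. C g \<in> sets (borel :: real measure))}"
  define N where "N = sigma (space M) \<E>"
  have \<E>_sets: "\<E> \<subseteq> sets M"
    unfolding \<E>_def by (auto intro!: sets.sets_Collect_finite_All)
  have \<E>_Pow: "\<E> \<subseteq> Pow (space M)" using \<E>_sets sets.space_closed by blast
  have [simp]: "space N = space M" unfolding N_def using \<E>_Pow by (rule space_measure_of)
  have sets_N: "sets N = sigma_sets (space M) \<E>" unfolding N_def using \<E>_Pow by (rule sets_measure_of)
  have N_le: "sets N \<subseteq> sets M"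
    unfolding sets_N using \<E>_sets by (rule sets.sigma_sets_subset)
  have stable: "Int_stable \<E>"
  proof (rule Int_stableI)
    fix a b assume "a \<in> \<E>" "b \<in> \<E>"
    then obtain I C J D where I: "finite I" "\<And>g. C g \<in> sets (borel :: real measure)"
        "a = {\<omega>\<in>space M. \<forall>g\<in>I. W \<omega> \<bullet> g \<in> C g}"
      and J: "finite J" "\<And>g. D g \<in> sets (borel :: real measure)"
        "b = {\<omega>\<in>space M. \<forall>g\<in>J. W \<omega> \<bullet> g \<in> D g}"
      unfolding \<E>_def by blast
    let ?F = "\<lambda>g. (if g \<in> I then C g else UNIV) \<inter> (if g \<in> J then D g else UNIV)"
    have "a \<inter> b = {\<omega>\<in>space M. \<forall>g\<in>I \<union> J. W \<omega> \<bullet> g \<in> ?F g}"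
      using I J by auto
    moreover have "\<forall>g. ?F g \<in> sets (borel :: real measure)" "finite (I \<union> J)"
      using I J by auto
    ultimately show "a \<inter> b \<in> \<E>"
      unfolding \<E>_def by (intro CollectI exI[of _ "I \<union> J"] exI[of _ ?F] conjI)
  qed
  let ?\<X> = "{\<xi> -` B \<inter> space M | B. B \<in> sets borel}"
  have stable_\<xi>: "Int_stable ?\<X>"
  proof (rule Int_stableI)
    fix a b assume "a \<in> ?\<X>" "b \<in> ?\<X>"
    then obtain B C where "B \<in> sets borel" "C \<in> sets borel" "a = \<xi> -` B \<inter> space M" "b = \<xi> -` C \<inter> space M"
      by blast
    then show "a \<inter> b \<in> ?\<X>" by (intro CollectI exI[of _ "B \<inter> C"]) auto
  qed
  have "indep_set ?\<X> \<E>"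
  proof (rule indep_setI[OF _ \<E>_sets])
    show "?\<X> \<subseteq> sets M" by auto
    fix a b assume "a \<in> ?\<X>" "b \<in> \<E>"
    then obtain B I C where "a = {\<omega>\<in>space M. \<xi> \<omega> \<in> B}" "B \<in> sets borel"
      "finite I" "\<And>g. C g \<in> sets borel" "b = {\<omega>\<in>space M. \<forall>g\<in>I. W \<omega> \<bullet> g \<in> C g}"
      unfolding \<E>_def by blast
    then show "prob (a \<inter> b) = prob a * prob b" using cylinder by simp
  qed
  then have "indep_set (sigma_sets (space M) ?\<X>) (sets N)"
    unfolding sets_N using stable_\<xi> stable by (rule indep_set_sigma_sets)
  then have indep: "prob (\<xi> -` B \<inter> space M \<inter> F) = prob (\<xi> -` B \<inter> space M) * prob F"
    if "B \<in> sets borel" "F \<in> sets N" for B F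
    using that by (intro indep_setD) (auto intro!: sigma_sets.Basic)
  have id [measurable]: "(\<lambda>\<omega>. \<omega>) \<in> measurable M N"
    using N_le by (auto simp: measurable_def Int_absorb2 dest: sets.sets_into_space)
  interpret X: prob_space "distr M borel \<xi>" by (rule prob_space_distr) simp
  interpret Y: prob_space "distr M N (\<lambda>\<omega>. \<omega>)" by (rule prob_space_distr) simp
  interpret XY: pair_sigma_finite "distr M borel \<xi>" "distr M N (\<lambda>\<omega>. \<omega>)" ..
  have law: "distr M borel \<xi> \<Otimes>\<^sub>M distr M N (\<lambda>\<omega>. \<omega>) = distr M (borel \<Otimes>\<^sub>M N) (\<lambda>\<omega>. (\<xi> \<omega>, \<omega>))"
  proof (rule pair_measure_eqI)
    fix B F assume "B \<in> sets (distr M borel \<xi>)" "F \<in> sets (distr M N (\<lambda>\<omega>. \<omega>))"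
    then have B [measurable]: "B \<in> sets borel" and F [measurable]: "F \<in> sets N" by auto
    then have "F \<subseteq> space M" "F \<in> sets M" using N_le sets.sets_into_space[of F N] by auto
    then have "(\<lambda>\<omega>. (\<xi> \<omega>, \<omega>)) -` (B \<times> F) \<inter> space M = \<xi> -` B \<inter> space M \<inter> F"
      "(\<lambda>\<omega>. \<omega>) -` F \<inter> space M = F" by auto
    then show "emeasure (distr M borel \<xi>) B * emeasure (distr M N (\<lambda>\<omega>. \<omega>)) F
        = emeasure (distr M (borel \<Otimes>\<^sub>M N) (\<lambda>\<omega>. (\<xi> \<omega>, \<omega>))) (B \<times> F)"
      using indep[OF B F] by (simp add: emeasure_distr emeasure_eq_measure ennreal_mult'[symmetric])
  qed (use X.sigma_finite_measure_axioms Y.sigma_finite_measure_axioms in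
      \<open>auto cong: sets_pair_measure_cong\<close>)
  \<comment> \<open>Passing to the smaller \<open>N\<close> loses nothing: scalar measurability
    holds by construction, the range of \<open>W\<close> is still separable, and Pettis' theorem
    applies.\<close>
  have "random_element N W"
  proof -
    obtain D where "countable D" "\<And>\<omega>. \<omega> \<in> space M \<Longrightarrow> W \<omega> \<in> closure D"
      using random_element_separable[OF W] by blast
    moreover have "(\<lambda>\<omega>. W \<omega> \<bullet> g) \<in> borel_measurable N" for g
    proof (rule measurableI)
      fix B :: "real set" assume "B \<in> sets borel"
      then have "(\<lambda>\<omega>. W \<omega> \<bullet> g) -` B \<inter> space N \<in> \<E>"
        unfolding \<E>_def by (auto intro!: exI[of _ "{g}"] exI[of _ "\<lambda>_. B"])
      then show "(\<lambda>\<omega>. W \<omega> \<bullet> g) -` B \<inter> space N \<in> sets N"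
        unfolding sets_N by (rule sigma_sets.Basic)
    qed simp
    ultimately show ?thesis by (intro random_elementI) auto
  qed
  then have "random_element (borel \<Otimes>\<^sub>M N) (\<lambda>p. W (snd p))"
    by (rule random_element_compose) simp
  moreover have "random_element (borel \<Otimes>\<^sub>M N) (\<lambda>p. fst p :: real)"
    by (rule random_element_real) simp
  ultimately have "random_element (borel \<Otimes>\<^sub>M N) (\<lambda>p. W (snd p) + fst p *\<^sub>R v)"
    by (rule random_element_compose2) (intro continuous_intros)
  note [measurable] = random_element_borel_measurable[OF this]
  let ?T = "{p \<in> space (borel \<Otimes>\<^sub>M N). W (snd p) + fst p *\<^sub>R v \<in> A}"
  have T: "?T \<in> sets (borel \<Otimes>\<^sub>M N)" by measurable
  have gauss: "centered_gaussian (distr M borel \<xi>)"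
    unfolding \<xi>_def by (rule gaussian_inner[OF P M Z_meas distr])
  have nondeg: "distr M borel \<xi> \<noteq> return borel 0"
  proof
    assume eq: "distr M borel \<xi> = return borel 0"
    have "expectation \<xi> = (\<integral>x. x \<partial>distr M borel \<xi>)" "(\<integral>\<omega>. \<xi> \<omega> * \<xi> \<omega> \<partial>M) = (\<integral>x. x * x \<partial>distr M borel \<xi>)"
      by (simp_all add: integral_distr)
    then have "cov M \<xi> \<xi> = 0" by (simp add: cov_def eq integral_return)
    then show False using gaussian_inner_cov[OF P M Z_meas distr, of f f] q by (simp add: \<xi>_def[symmetric] q_def)
  qed
  have "emeasure M {\<omega>\<in>space M. Z \<omega> \<in> A} = emeasure (distr M (borel \<Otimes>\<^sub>M N) (\<lambda>\<omega>. (\<xi> \<omega>, \<omega>))) ?T"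
    using T by (subst emeasure_distr) (auto simp: W_def space_pair_measure intro!: arg_cong[where f="emeasure M"])
  also have "\<dots> = (\<integral>\<^sup>+\<omega>. emeasure (distr M borel \<xi>) ((\<lambda>t. (t, \<omega>)) -` ?T) \<partial>distr M N (\<lambda>\<omega>. \<omega>))"
    unfolding law[symmetric] using T by (intro XY.emeasure_pair_measure_alt2) (simp cong: sets_pair_measure_cong)
  also have "\<dots> = (\<integral>\<^sup>+\<omega>. 0 \<partial>distr M N (\<lambda>\<omega>. \<omega>))"
  proof (rule nn_integral_cong)
    fix \<omega>
    \<comment> \<open>Since \<open>v = S f /\<^sub>R q\<close>, the parameter along \<open>v\<close>
      is \<open>q\<close> times the parameter along \<open>S f\<close>.\<close>
    have "(\<lambda>t. (t, \<omega>)) -` ?T \<subseteq> (\<lambda>t. q * t) ` {t. W \<omega> + t *\<^sub>R S f \<in> A}"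
      using q by (auto simp: v_def intro!: image_eqI[where x="_ / q"] simp: field_simps)
    then have "countable ((\<lambda>t. (t, \<omega>)) -` ?T)"
      using lines by (meson countable_image countable_subset)
    then show "emeasure (distr M borel \<xi>) ((\<lambda>t. (t, \<omega>)) -` ?T) = 0"
      by (rule emeasure_centered_gaussian_countable[OF gauss nondeg])
  qed
  finally show ?thesis by simp
qed

subsection \<open>The L-MMD statistic\<close>

text \<open>The difference of the two sides extends to the entire function \<open>f\<close>. It is
  not constant because the exponential of the quadratic outgrows, along the positive real axis,
  every exponential of a linear function.\<close>

lemma countable_exp_sum_eq_exp_quadratic:
  fixes a p s :: "'i \<Rightarrow> real"
  assumes q2: "q2 > 0" and d: "d \<noteq> 0"
  shows "countable {t::real. (\<Sum>j\<in>J. a j * exp (p j + t * s j)) + c = d * exp (q0 + q1 * t + q2 * t\<^sup>2)}"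
proof -
  define f :: "complex \<Rightarrow> complex" where
    "f z = (\<Sum>j\<in>J. of_real (a j) * exp (of_real (p j) + z * of_real (s j))) + of_real c
      - of_real d * exp (of_real q0 + of_real q1 * z + of_real q2 * z\<^sup>2)" for z
  define g where "g t = (\<Sum>j\<in>J. a j * exp (p j + t * s j)) + c - d * exp (q0 + q1 * t + q2 * t\<^sup>2)" for t :: real
  have fg: "f (of_real t) = of_real (g t)" for t
    by (simp add: f_def g_def exp_of_real[symmetric])
  have "\<not> f constant_on UNIV"
  proof
    assume "f constant_on UNIV"
    then obtain k where "\<And>z. f z = k" by (auto simp: constant_on_def)
    then have k: "g t = g 0" for t
      using fg by (metis of_real_eq_iff)
    define e where "e = g 0"
    \<comment> \<open>If \<open>g\<close> had the constant value \<open>e\<close>, dividing by the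
      exponential of the quadratic would leave a quantity that tends to 0 and yet always equals
      \<open>d\<close>.\<close>
    have "((\<lambda>t. (\<Sum>j\<in>J. a j * exp (p j + t * s j - (q0 + q1 * t + q2 * t\<^sup>2)))
        + (c - e) * exp (- (q0 + q1 * t + q2 * t\<^sup>2))) \<longlongrightarrow> (\<Sum>j\<in>J. a j * 0) + (c - e) * 0) at_top"
    proof (intro tendsto_intros)
      show "((\<lambda>t. exp (- (q0 + q1 * t + q2 * t\<^sup>2))) \<longlongrightarrow> 0) at_top"
        using q2 by real_asymp
      show "((\<lambda>t. exp (p j + t * s j - (q0 + q1 * t + q2 * t\<^sup>2))) \<longlongrightarrow> 0) at_top" for j
        using q2 by real_asymp
    qed
    moreover have "(\<Sum>j\<in>J. a j * exp (p j + t * s j - (q0 + q1 * t + q2 * t\<^sup>2)))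
        + (c - e) * exp (- (q0 + q1 * t + q2 * t\<^sup>2)) = d" for t
    proof -
      let ?Q = "q0 + q1 * t + q2 * t\<^sup>2"
      have "(\<Sum>j\<in>J. a j * exp (p j + t * s j)) + (c - e) = d * exp ?Q"
        using k[of t] by (simp add: g_def e_def)
      then have "((\<Sum>j\<in>J. a j * exp (p j + t * s j)) + (c - e)) * exp (- ?Q) = d * (exp ?Q * exp (- ?Q))"
        by simp
      moreover have "exp (y - ?Q) = exp y * exp (- ?Q)" for y
        by (simp only: diff_conv_add_uminus exp_add)
      ultimately show ?thesis
        unfolding exp_minus_inverse mult_1_right distrib_right sum_distrib_right
        by (simp only: mult.assoc)
    qed
    ultimately have "((\<lambda>t::real. d) \<longlongrightarrow> 0) at_top" by simp
    with d show False by (simp add: tendsto_const_iff)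
  qed
  moreover have "f holomorphic_on UNIV"
    unfolding f_def by (intro holomorphic_intros)
  ultimately have "countable {z\<in>UNIV. f z = 0}"
    by (intro holomorphic_countable_zeros) auto
  then have "countable (complex_of_real ` (of_real -` {z. f z = 0}))"
    by (rule countable_subset[rotated]) auto
  then have "countable (of_real -` {z. f z = 0} :: real set)"
    by (rule countable_image_inj_on) (auto simp: inj_on_def)
  also have "of_real -` {z. f z = 0} = {t. g t = 0}"
    by (auto simp: fg)
  finally show ?thesis by (simp add: g_def)
qed

lemma lmmd_stat_cong:
  assumes "\<And>i. i \<in> {1..n} \<Longrightarrow> y i = y' i"
  shows "lmmd_stat S n y = lmmd_stat S n y'"
proof -
  have "(\<Sum>(i, j)\<in>{(i, j). i \<in> {1..n} \<and> j \<in> {1..n} \<and> i \<noteq> j}. exp (y i \<bullet> y j))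
      = (\<Sum>(i, j)\<in>{(i, j). i \<in> {1..n} \<and> j \<in> {1..n} \<and> i \<noteq> j}. exp (y' i \<bullet> y' j))"
    using assms by (intro sum.cong) auto
  moreover have "(\<Sum>i\<in>{1..n}. exp (1 / 2 * (y i \<bullet> S (y i)))) = (\<Sum>i\<in>{1..n}. exp (1 / 2 * (y' i \<bullet> S (y' i))))"
    using assms by (intro sum.cong) auto
  ultimately show ?thesis unfolding lmmd_stat_def by simp
qed

lemma lmmd_stat_measurable:
  fixes y :: "nat \<Rightarrow> 'w \<Rightarrow> 'h::{real_inner,banach}"
  assumes S: "bounded_linear S" and y: "\<And>i. i \<in> {1..n} \<Longrightarrow> random_element N (y i)"
  shows "(\<lambda>\<omega>. lmmd_stat S n (\<lambda>i. y i \<omega>)) \<in> borel_measurable N"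
proof -
  have "(\<lambda>\<omega>. y i \<omega> \<bullet> S (y i \<omega>)) \<in> borel_measurable N" if "i \<in> {1..n}" for i
    by (intro random_element_borel_measurable random_element_compose2[OF y[OF that] y[OF that], of "\<lambda>a b. a \<bullet> S b"]
        continuous_intros bounded_linear.continuous_on[OF S])
  moreover have "(\<lambda>\<omega>. y i \<omega> \<bullet> y j \<omega>) \<in> borel_measurable N" if "i \<in> {1..n}" "j \<in> {1..n}" for i j
    using that y by (intro random_element_inner)
  ultimately show ?thesis
    unfolding lmmd_stat_def case_prod_unfold
    by (intro borel_measurable_add borel_measurable_diff borel_measurable_times borel_measurable_sum
        borel_measurable_const measurable_compose[OF _ borel_measurable_exp]) auto
qed

text \<open>The statistic need not be measurable for the product of the Borel \<open>\<sigma>\<close>-algebras, but it is on a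
  set of samples that lie in a separable subset.\<close>

lemma lmmd_stat_extension:
  fixes S :: "'h::{real_inner,banach} \<Rightarrow> 'h"
  assumes S: "bounded_linear S" and D: "countable D"
  obtains h where "h \<in> borel_measurable (PiM {1..n} (\<lambda>_. borel))"
    "\<And>y. (\<And>i. i \<in> {1..n} \<Longrightarrow> y i \<in> closure D) \<Longrightarrow> h y = lmmd_stat S n y"
proof -
  let ?P = "PiM {1..n} (\<lambda>_. borel :: 'h measure)"
  let ?Q = "\<lambda>y. \<forall>i\<in>{1..n}. y i \<in> closure D"
  have "(\<lambda>y. lmmd_stat S n y) \<in> borel_measurable (restrict_space ?P {y. ?Q y})"
  proof (rule lmmd_stat_measurable[OF S])
    fix i assume i: "i \<in> {1..n}"
    show "random_element (restrict_space ?P {y. ?Q y}) (\<lambda>y. y i)"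
    \<comment> \<open>Restricted to these samples each coordinate has its values in
      \<open>closure D\<close>, so scalar measurability is enough.\<close>
    proof (rule random_elementI[OF D])
      show "y i \<in> closure D" if "y \<in> space (restrict_space ?P {y. ?Q y})" for y
        using that i by (auto simp: space_restrict_space)
      have "(\<lambda>z. z \<bullet> g) \<in> borel_measurable borel" for g :: 'h
        by (intro borel_measurable_continuous_onI continuous_intros)
      then show "(\<lambda>y. y i \<bullet> g) \<in> borel_measurable (restrict_space ?P {y. ?Q y})" for g
        using i by (intro measurable_restrict_space1 measurable_compose[OF measurable_component_singleton]) auto
    qed
  qed
  moreover have "{y \<in> space ?P. ?Q y} \<in> sets ?P"
  proof -
    have [measurable]: "closure D \<in> sets (borel :: 'h measure)" by (intro borel_closed closed_closure)
    show ?thesis by measurable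
  qed
  ultimately have "(\<lambda>y. if ?Q y then lmmd_stat S n y else 0) \<in> borel_measurable ?P"
    by (simp add: measurable_If_restrict_space_iff)
  then show ?thesis by (rule that) auto
qed

text \<open>Isolates the first sample point in the shape needed for the zero count. Each pair of 1
  and \<open>j\<close> occurs in both orders, whence the factor 2; \<open>R\<close> collects all
  terms free of \<open>z\<close>, including \<open>b_squared S\<close>.\<close>

lemma lmmd_stat_update:
  fixes S :: "'h::real_inner \<Rightarrow> 'h"
  assumes "n \<ge> 1"
  obtains R where "\<And>z. lmmd_stat S n (y(1 := z)) =
    (\<Sum>j\<in>{2..n}. 2 / (real n - 1) * exp (z \<bullet> y j)) + R - 2 * exp (1 / 2 * (z \<bullet> S z))"
proof -
  have range: "{1..n} = insert 1 {2..n}" using assms by auto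
  have split: "(\<Sum>(i, j)\<in>{(i, j). i \<in> {1..n} \<and> j \<in> {1..n} \<and> i \<noteq> j}. g i j)
      = (\<Sum>j\<in>{2..n}. g 1 j + g j 1) + (\<Sum>i\<in>{2..n}. \<Sum>j\<in>{2..n} - {i}. g i j)" for g :: "nat \<Rightarrow> nat \<Rightarrow> real"
  proof -
    have "{(i, j). i \<in> {1..n} \<and> j \<in> {1..n} \<and> i \<noteq> j} = Sigma {1..n} (\<lambda>i. {1..n} - {i})" by auto
    then have "(\<Sum>(i, j)\<in>{(i, j). i \<in> {1..n} \<and> j \<in> {1..n} \<and> i \<noteq> j}. g i j)
        = (\<Sum>i\<in>{1..n}. \<Sum>j\<in>{1..n} - {i}. g i j)"
      by (simp add: sum.Sigma)
    also have "\<dots> = (\<Sum>j\<in>{2..n}. g 1 j) + (\<Sum>i\<in>{2..n}. \<Sum>j\<in>{1..n} - {i}. g i j)"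
    proof -
      have "{1..n} - {1} = {2..n}" by auto
      then show ?thesis unfolding range by simp
    qed
    also have "(\<Sum>i\<in>{2..n}. \<Sum>j\<in>{1..n} - {i}. g i j) = (\<Sum>i\<in>{2..n}. g i 1 + (\<Sum>j\<in>{2..n} - {i}. g i j))"
    proof (rule sum.cong)
      fix i assume "i \<in> {2..n}"
      then have "{1..n} - {i} = insert 1 ({2..n} - {i})" by auto
      then show "(\<Sum>j\<in>{1..n} - {i}. g i j) = g i 1 + (\<Sum>j\<in>{2..n} - {i}. g i j)" by simp
    qed simp
    finally show ?thesis by (simp add: sum.distrib)
  qed
  let ?R1 = "\<Sum>i\<in>{2..n}. \<Sum>j\<in>{2..n} - {i}. exp (y i \<bullet> y j)"
  let ?R2 = "\<Sum>i\<in>{2..n}. exp (1 / 2 * (y i \<bullet> S (y i)))"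
  have "lmmd_stat S n (y(1 := z)) = (\<Sum>j\<in>{2..n}. 2 / (real n - 1) * exp (z \<bullet> y j))
      + (1 / (real n - 1) * ?R1 - 2 * ?R2 + real n * b_squared S) - 2 * exp (1 / 2 * (z \<bullet> S z))" for z
  proof -
    have upd: "(y(1 := z)) i = y i" if "i \<in> {2..n}" for i using that by auto
    have "(\<Sum>j\<in>{2..n}. exp ((y(1 := z)) 1 \<bullet> (y(1 := z)) j) + exp ((y(1 := z)) j \<bullet> (y(1 := z)) 1))
        = (\<Sum>j\<in>{2..n}. 2 * exp (z \<bullet> y j))"
      by (intro sum.cong) (auto simp: inner_commute)
    moreover have "(\<Sum>i\<in>{2..n}. \<Sum>j\<in>{2..n} - {i}. exp ((y(1 := z)) i \<bullet> (y(1 := z)) j)) = ?R1"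
      by (intro sum.cong) auto
    moreover have "(\<Sum>i\<in>{1..n}. exp (1 / 2 * ((y(1 := z)) i \<bullet> S ((y(1 := z)) i)))) = exp (1 / 2 * (z \<bullet> S z)) + ?R2"
    proof -
      have "(\<Sum>i\<in>{2..n}. exp (1 / 2 * ((y(1 := z)) i \<bullet> S ((y(1 := z)) i)))) = ?R2"
        by (intro sum.cong) auto
      then show ?thesis unfolding range by (subst sum.insert) auto
    qed
    ultimately show ?thesis
      unfolding lmmd_stat_def split
      by (simp only: distrib_left right_diff_distrib sum_distrib_left) (simp add: algebra_simps)
  qed
  then show ?thesis by (rule that)
qed

text \<open>With only one sample point moving, continuity already gives a Borel set, wherever the
  other points lie.\<close>

lemma lmmd_stat_level_closed:
  fixes S :: "'h::{real_inner,banach} \<Rightarrow> 'h"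
  assumes S: "bounded_linear S" and n: "n \<ge> 1"
  shows "closed {z. lmmd_stat S n (y(1 := z)) = c}"
proof -
  obtain R where R: "\<And>z. lmmd_stat S n (y(1 := z)) =
    (\<Sum>j\<in>{2..n}. 2 / (real n - 1) * exp (z \<bullet> y j)) + R - 2 * exp (1 / 2 * (z \<bullet> S z))"
    using lmmd_stat_update[OF n] by blast
  show ?thesis
    unfolding R by (intro closed_Collect_eq continuous_intros bounded_linear.continuous_on[OF S])
qed

text \<open>\<open>M\<close> and \<open>Z\<close> realise \<open>P\<close> as the law of a separably
  valued variable, as the decomposition behind \<open>gaussian_null_set\<close> requires.\<close>

lemma lmmd_stat_level_null:
  fixes S :: "'h::{real_inner,banach} \<Rightarrow> 'h"
  assumes P: "gaussian_measure P S" and ne: "S \<noteq> (\<lambda>_. 0)" and n: "n \<ge> 1"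
    and "prob_space M" "random_element M Z" "distr M borel Z = P"
  shows "emeasure P {z. lmmd_stat S n (y(1 := z)) = c} = 0"
proof -
  interpret S: bounded_linear S using P by (simp add: gaussian_measure_def)
  let ?A = "{z. lmmd_stat S n (y(1 := z)) = c}"
  have A: "?A \<in> sets borel"
    using lmmd_stat_level_closed[OF S.bounded_linear_axioms n] by (rule borel_closed)
  obtain f where "S f \<noteq> 0" using ne by auto
  define v where "v = S f"
  have "v \<noteq> 0" using \<open>S f \<noteq> 0\<close> by (simp add: v_def)
  have f: "S f \<bullet> f > 0"
    using gaussian_measure_kernel[OF P, of f] gaussian_measure_nonneg[OF P, of f] \<open>S f \<noteq> 0\<close> by force
  \<comment> \<open>Two positivity facts are needed: \<open>S f \<bullet> f > 0\<close> makes the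
    conditioned functional nondegenerate, while \<open>S v \<bullet> v > 0\<close> is the leading
    coefficient along the line. The latter follows from symmetry:
    \<open>S v \<bullet> f = v \<bullet> v\<close>.\<close>
  have "S v \<noteq> 0"
  proof
    assume "S v = 0"
    then have "v \<bullet> v = 0" using gaussian_measure_symmetric[OF P, of v f] by (simp add: v_def)
    with \<open>v \<noteq> 0\<close> show False by simp
  qed
  then have v: "S v \<bullet> v > 0"
    using gaussian_measure_kernel[OF P, of v] gaussian_measure_nonneg[OF P, of v] by force
  obtain R where R: "\<And>z. lmmd_stat S n (y(1 := z)) =
    (\<Sum>j\<in>{2..n}. 2 / (real n - 1) * exp (z \<bullet> y j)) + R - 2 * exp (1 / 2 * (z \<bullet> S z))"
    using lmmd_stat_update[OF n] by blast
  have lines: "countable {t. w + t *\<^sub>R v \<in> ?A}" for w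
  proof -
    have "(w + t *\<^sub>R v) \<bullet> S (w + t *\<^sub>R v) = S w \<bullet> w + 2 * (S w \<bullet> v) * t + (S v \<bullet> v) * t\<^sup>2" for t
      using gaussian_measure_symmetric[OF P, of v w]
      by (simp add: S.add S.scaleR inner_add inner_commute power2_eq_square algebra_simps)
    then have quad: "1 / 2 * ((w + t *\<^sub>R v) \<bullet> S (w + t *\<^sub>R v))
        = S w \<bullet> w / 2 + (S w \<bullet> v) * t + (S v \<bullet> v) / 2 * t\<^sup>2" for t
      by simp
    have lin: "(w + t *\<^sub>R v) \<bullet> y j = w \<bullet> y j + t * (v \<bullet> y j)" for t j
      by (simp add: inner_add)
    have "{t. w + t *\<^sub>R v \<in> ?A} = {t. (\<Sum>j\<in>{2..n}. 2 / (real n - 1) * exp (w \<bullet> y j + t * (v \<bullet> y j))) + (R - c)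
        = 2 * exp (S w \<bullet> w / 2 + (S w \<bullet> v) * t + (S v \<bullet> v) / 2 * t\<^sup>2)}"
      unfolding mem_Collect_eq R quad lin by (auto simp: algebra_simps)
    also have "countable \<dots>"
      using v by (intro countable_exp_sum_eq_exp_quadratic) auto
    finally show ?thesis .
  qed
  have "emeasure M {\<omega>\<in>space M. Z \<omega> \<in> ?A} = 0"
    using gaussian_null_set[OF P assms(4-6) f A] lines by (simp add: v_def)
  moreover have "emeasure P ?A = emeasure M {\<omega>\<in>space M. Z \<omega> \<in> ?A}"
    unfolding assms(6)[symmetric] using A random_element_borel_measurable[OF assms(5)]
    by (subst emeasure_distr) (auto simp: vimage_def Int_def conj_commute)
  ultimately show ?thesis by simp
qed

section \<open>Ranks of exchangeable variables and the level of the test\<close>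

lemma rank_event_measurable:
  fixes x :: "'i \<Rightarrow> 'a \<Rightarrow> real"
  assumes I: "finite I" and j: "j \<in> I" and x: "\<And>i. i \<in> I \<Longrightarrow> x i \<in> borel_measurable M"
  shows "{\<omega>\<in>space M. l \<le> card {b\<in>I. x b \<omega> < x j \<omega>}} \<in> sets M"
proof -
  have card: "real (card {b\<in>I. x b \<omega> < x j \<omega>}) = (\<Sum>b\<in>I. if x b \<omega> < x j \<omega> then 1 else 0)" for \<omega>
    using I by (simp add: sum.If_cases Int_def)
  have iff: "l \<le> card {b\<in>I. x b \<omega> < x j \<omega>} \<longleftrightarrow> real l \<le> (\<Sum>b\<in>I. if x b \<omega> < x j \<omega> then 1 else 0)" for \<omega>
    unfolding card[symmetric] by simp
  have "(\<lambda>\<omega>. \<Sum>b\<in>I. if x b \<omega> < x j \<omega> then 1 else 0 :: real) \<in> borel_measurable M"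
    using x j by (intro borel_measurable_sum measurable_If borel_measurable_less) auto
  then show ?thesis unfolding iff by measurable
qed

text \<open>By linearity \<open>card I * p\<close> is the expected number of indices with at least
  \<open>l\<close> values strictly below them, and the counting lemmas bound this number pointwise.
  All that is used of exchangeability is the common value \<open>p\<close>.\<close>

lemma (in prob_space) rank_prob:
  fixes x :: "'i \<Rightarrow> 'a \<Rightarrow> real"
  assumes I: "finite I" and x: "\<And>i. i \<in> I \<Longrightarrow> x i \<in> borel_measurable M"
    and exch: "\<And>j. j \<in> I \<Longrightarrow> prob {\<omega>\<in>space M. l \<le> card {b\<in>I. x b \<omega> < x j \<omega>}} = p"
  shows rank_prob_le: "real (card I) * p \<le> real (card I - l)"
    and rank_prob_ge: "AE \<omega> in M. inj_on (\<lambda>b. x b \<omega>) I \<Longrightarrow> real (card I - l) \<le> real (card I) * p"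
proof -
  define E where "E j = {\<omega>\<in>space M. l \<le> card {b\<in>I. x b \<omega> < x j \<omega>}}" for j
  have E: "E j \<in> sets M" if "j \<in> I" for j
    unfolding E_def using I that x by (rule rank_event_measurable)
  define c where "c \<omega> = real (card {j\<in>I. l \<le> card {b\<in>I. x b \<omega> < x j \<omega>}})" for \<omega>
  have c: "(\<Sum>j\<in>I. indicat_real (E j) \<omega>) = c \<omega>" if "\<omega> \<in> space M" for \<omega>
    using I that by (simp add: c_def E_def indicator_def sum.If_cases Int_def)
  have int: "integrable M (\<lambda>\<omega>. \<Sum>j\<in>I. indicat_real (E j) \<omega>)"
    using E by (intro Bochner_Integration.integrable_sum integrable_real_indicator) (auto simp: emeasure_eq_measure)
  then have int_c: "integrable M c"
    using c by (simp cong: Bochner_Integration.integrable_cong)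
  have "real (card I) * p = (\<Sum>j\<in>I. prob (E j))"
    using exch by (simp add: E_def)
  also have "\<dots> = (\<Sum>j\<in>I. \<integral>\<omega>. indicat_real (E j) \<omega> \<partial>M)"
    using E by (intro sum.cong) (auto simp: sets.Int_space_eq1)
  also have "\<dots> = (\<integral>\<omega>. (\<Sum>j\<in>I. indicat_real (E j) \<omega>) \<partial>M)"
    using E by (intro Bochner_Integration.integral_sum[symmetric] integrable_real_indicator) (auto simp: emeasure_eq_measure)
  also have "\<dots> = (\<integral>\<omega>. c \<omega> \<partial>M)"
    using c by (intro Bochner_Integration.integral_cong) auto
  finally have eq: "real (card I) * p = expectation c" .
  show "real (card I) * p \<le> real (card I - l)"
    unfolding eq using card_many_below_le[OF I]
    by (intro integral_le_const int_c) (auto simp: c_def)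
  show "real (card I - l) \<le> real (card I) * p" if "AE \<omega> in M. inj_on (\<lambda>b. x b \<omega>) I"
    unfolding eq
  proof (rule integral_ge_const[OF int_c])
    show "AE \<omega> in M. real (card I - l) \<le> c \<omega>"
      using that by eventually_elim (simp add: c_def card_many_below_ge[OF I])
  qed
qed

text \<open>The proviso on the lower bound excludes the point mass at 0. If \<open>S\<close> is
  zero, all sample points vanish almost surely and all values of the statistic tie, so the strict
  inequality has probability 0, which is less than \<alpha> - 1/(B+1) as soon as \<alpha> >
  1/(B+1).\<close>

theorem proposition4p1:
  fixes \<X> :: "'x set"
    and k :: "'x \<Rightarrow> 'x \<Rightarrow> real"
    and app :: "'h::{real_inner,banach} \<Rightarrow> 'x \<Rightarrow> real"
    and K :: "'x \<Rightarrow> 'h"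
    and S :: "'h \<Rightarrow> 'h"
    and P P\<^sub>0 :: "'h measure"
    and n B :: nat
    and \<alpha> :: real
    and M :: "'w measure"
    and MX Q :: "'x measure"
    and X :: "nat \<Rightarrow> 'w \<Rightarrow> 'x"
    and Y :: "nat \<Rightarrow> 'w \<Rightarrow> 'h"
    and Z :: "nat \<Rightarrow> nat \<Rightarrow> 'w \<Rightarrow> 'h"
  assumes rkhs: "is_rkhs \<X> k app K"
    and n: "n \<ge> 2" and B: "B \<ge> 1" and \<alpha>: "0 < \<alpha>" "\<alpha> < 1"
    and P0: "gaussian_measure P\<^sub>0 S"
    and eig: "\<forall>l\<in>eigenvalues S. l < 1"
    and M: "prob_space M"
    and MX: "space MX = \<X>"
    and X_indep: "prob_space.indep_vars M (\<lambda>_. MX) X {1..n}"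
    and X_distr: "\<forall>i\<in>{1..n}. distr M MX (X i) = Q"
    and Y: "\<forall>i\<in>{1..n}. \<forall>\<omega>\<in>space M. Y i \<omega> = K (X i \<omega>)"
    and Y_meas: "\<forall>i\<in>{1..n}. random_element M (Y i)"
    and Y_distr: "\<forall>i\<in>{1..n}. distr M borel (Y i) = P"
    and Z_meas: "\<forall>b\<in>{1..B}. \<forall>i\<in>{1..n}. random_element M (Z b i)"
    and Z_distr: "\<forall>b\<in>{1..B}. \<forall>i\<in>{1..n}. distr M borel (Z b i) = P\<^sub>0"
    and YZ_indep: "prob_space.indep_vars M (\<lambda>_. borel)
        (\<lambda>(b, i). if b = 0 then Y i else Z b i) ({0..B} \<times> {1..n})"
    and null: "P = P\<^sub>0"
    and \<alpha>_ge: "\<alpha> \<ge> 1 / (real B + 1)"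
  shows "let p = \<P>(\<omega> in M. ereal (lmmd_stat S n (\<lambda>i. Y i \<omega>))
              > mc_quantile \<alpha> B (\<lambda>b. lmmd_stat S n (\<lambda>i. Z b i \<omega>)))
         in (S \<noteq> (\<lambda>_. 0) \<longrightarrow> \<alpha> - 1 / (real B + 1) \<le> p) \<and> p \<le> \<alpha>"
proof -
  interpret prob_space M by fact
  interpret P: prob_space P\<^sub>0 using P0 by (simp add: gaussian_measure_def)
  have S: "bounded_linear S" and sets_P: "sets P\<^sub>0 = sets borel" using P0 by (simp_all add: gaussian_measure_def)
  \<comment> \<open>Row 0 of the array holds the observations, rows 1 to \<open>B\<close> the
    simulated samples.\<close>
  define I where "I = {0..B} \<times> {1..n}"
  define V where "V = (\<lambda>(b, i). if b = 0 then Y i else Z b i)"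
  have V: "random_element M (V p)" "distr M borel (V p) = P\<^sub>0" if "p \<in> I" for p
    using that Y_meas Z_meas Y_distr Z_distr null by (auto simp: I_def V_def)
  note V_meas = random_element_borel_measurable[OF V(1)]
  obtain D where D: "countable D" and V_D: "\<And>p \<omega>. p \<in> I \<Longrightarrow> \<omega> \<in> space M \<Longrightarrow> V p \<omega> \<in> closure D"
  proof -
    have "\<exists>D. countable D \<and> (\<forall>\<omega>\<in>space M. V p \<omega> \<in> closure D)" if "p \<in> I" for p
      using random_element_separable[OF V(1)[OF that]] by metis
    then obtain D where D: "\<And>p. p \<in> I \<Longrightarrow> countable (D p)"
      "\<And>p \<omega>. p \<in> I \<Longrightarrow> \<omega> \<in> space M \<Longrightarrow> V p \<omega> \<in> closure (D p)" by metis
    have "countable (\<Union>p\<in>I. D p)" using D(1) by (intro countable_UN) (auto simp: I_def)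
    moreover have "V p \<omega> \<in> closure (\<Union>p\<in>I. D p)" if "p \<in> I" "\<omega> \<in> space M" for p \<omega>
      using D(2)[OF that] closure_mono[of "D p" "\<Union>p\<in>I. D p"] that by blast
    ultimately show ?thesis by (rule that)
  qed
  obtain h where h [measurable]: "h \<in> borel_measurable (PiM {1..n} (\<lambda>_. borel))"
    and h_eq: "\<And>y. (\<And>i. i \<in> {1..n} \<Longrightarrow> y i \<in> closure D) \<Longrightarrow> h y = lmmd_stat S n y"
    using lmmd_stat_extension[OF S D] by blast
  \<comment> \<open>The argument moves to the law of the whole array, where swapping rows preserves
    the measure and a single coordinate can be integrated out. There \<open>L\<close> uses the
    measurable \<open>h\<close>, which agrees with the statistic on the range of
    \<open>J\<close>.\<close>
  define N where "N = PiM I (\<lambda>_. P\<^sub>0)"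
  define J where "J \<omega> = (\<lambda>p\<in>I. V p \<omega>)" for \<omega>
  define L where "L b x = h (\<lambda>i\<in>{1..n}. x (b, i))" for b and x :: "nat \<times> nat \<Rightarrow> 'h"
  have sets_N: "sets N = sets (PiM I (\<lambda>_. borel))"
    unfolding N_def using sets_P by (intro sets_PiM_cong) auto
  note space_N = sets_eq_imp_space_eq[OF sets_N]
  have J: "J \<in> measurable M N"
    unfolding measurable_cong_sets[OF refl sets_N] J_def using V_meas by (intro measurable_restrict)
  have law: "distr M N J = N"
  proof -
    have "I \<noteq> {}" using n by (auto simp: I_def)
    have "distr M N J = distr M (PiM I (\<lambda>_. borel)) J"
      by (rule distr_cong) (auto simp: sets_N)
    also have "\<dots> = PiM I (\<lambda>p. distr M borel (V p))"
      using iffD1[OF indep_vars_iff_distr_eq_PiM'[OF \<open>I \<noteq> {}\<close> V_meas] YZ_indep[folded V_def I_def]]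
      by (simp only: J_def[abs_def])
    also have "\<dots> = N"
      unfolding N_def using V(2) by (intro PiM_cong) auto
    finally show ?thesis .
  qed
  interpret N: prob_space N using prob_space_distr[OF J] by (simp only: law)
  have coord: "(\<lambda>x. x p) \<in> borel_measurable N" if "p \<in> I" for p
    unfolding measurable_cong_sets[OF sets_N refl] using that by (rule measurable_component_singleton)
  have L_meas: "L b \<in> borel_measurable N" if "b \<in> {0..B}" for b
    unfolding L_def using that
    by (intro measurable_compose[OF measurable_restrict h] coord) (auto simp: I_def)
  have L_eq: "L b x = lmmd_stat S n (\<lambda>i. x (b, i))" if "\<forall>p\<in>I. x p \<in> closure D" "b \<in> {0..B}" for b x
  proof -
    have "L b x = lmmd_stat S n (\<lambda>i\<in>{1..n}. x (b, i))"
      unfolding L_def using that by (intro h_eq) (auto simp: I_def)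
    also have "\<dots> = lmmd_stat S n (\<lambda>i. x (b, i))" by (rule lmmd_stat_cong) simp
    finally show ?thesis .
  qed
  have L_J: "L b (J \<omega>) = lmmd_stat S n (\<lambda>i. V (b, i) \<omega>)" if "b \<in> {0..B}" "\<omega> \<in> space M" for b \<omega>
  proof -
    have "L b (J \<omega>) = lmmd_stat S n (\<lambda>i. J \<omega> (b, i))"
      using that V_D by (intro L_eq) (auto simp: J_def)
    also have "\<dots> = lmmd_stat S n (\<lambda>i. V (b, i) \<omega>)"
      using that by (intro lmmd_stat_cong) (auto simp: J_def I_def)
    finally show ?thesis .
  qed
  define l where "l = nat \<lfloor>real B + 2 - \<alpha> * (real B + 1)\<rfloor>"
  define E where "E j = {x\<in>space N. l \<le> card {b\<in>{0..B}. L b x < L j x}}" for j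
  have E_meas: "E j \<in> sets N" if "j \<in> {0..B}" for j
    unfolding E_def using that L_meas by (intro rank_event_measurable) auto
  define p where "p = N.prob (E 0)"
  have exch: "N.prob (E j) = p" if j: "j \<in> {0..B}" for j
  proof -
    \<comment> \<open>Exchanging rows 0 and \<open>j\<close> preserves the product law and pulls
      \<open>E 0\<close> back to \<open>E j\<close>; the other rows are at most permuted, which
      leaves the count unchanged.\<close>
    define \<tau> where "\<tau> = Transposition.transpose 0 j"
    define f where "f = map_prod \<tau> (\<lambda>i::nat. i)"
    define R where "R x = (\<lambda>p\<in>I. x (f p))" for x :: "nat \<times> nat \<Rightarrow> 'h"
    have \<tau>: "\<tau> b \<in> {0..B}" "\<tau> (\<tau> b) = b" if "b \<in> {0..B}" for b
      using that j by (auto simp: \<tau>_def Transposition.transpose_def)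
    have "inj \<tau>" by (simp add: \<tau>_def)
    then have "inj f" unfolding f_def by (intro prod.inj_map) auto
    then have f: "inj_on f I" by (rule inj_on_subset) simp
    have f_I: "f p \<in> I" if "p \<in> I" for p
      using \<tau>(1) that by (auto simp: f_def I_def)
    have R_law: "distr N N R = N"
      unfolding N_def R_def using f f_I P.prob_space_axioms by (intro distr_PiM_reindex) auto
    have R: "R \<in> measurable N N"
      unfolding measurable_cong_sets[OF refl sets_N] R_def
      using f_I by (intro measurable_restrict coord)
    have L_R: "L b (R x) = L (\<tau> b) x" if "b \<in> {0..B}" for b x
      using that unfolding L_def by (intro arg_cong[where f=h] restrict_ext) (auto simp: R_def f_def I_def)
    have "{b\<in>{0..B}. L (\<tau> b) x < L j x} = \<tau> ` {b\<in>{0..B}. L b x < L j x}" for x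
      using \<tau> by (auto simp: image_iff) metis
    moreover have "inj_on \<tau> A" for A using \<open>inj \<tau>\<close> by (rule inj_on_subset) simp
    ultimately have card: "card {b\<in>{0..B}. L (\<tau> b) x < L j x} = card {b\<in>{0..B}. L b x < L j x}" for x
      by (simp add: card_image)
    have "\<tau> 0 = j" by (simp add: \<tau>_def)
    then have "{b\<in>{0..B}. L b (R x) < L 0 (R x)} = {b\<in>{0..B}. L (\<tau> b) x < L j x}" for x
      using L_R by auto
    then have "R -` E 0 \<inter> space N = E j"
      using measurable_space[OF R] card by (auto simp: E_def)
    moreover have "p = measure (distr N N R) (E 0)" unfolding p_def R_law ..
    ultimately show ?thesis using R E_meas[of 0] by (simp add: measure_distr)
  qed
  have p_eq: "\<P>(\<omega> in M. ereal (lmmd_stat S n (\<lambda>i. Y i \<omega>))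
      > mc_quantile \<alpha> B (\<lambda>b. lmmd_stat S n (\<lambda>i. Z b i \<omega>))) = p"
  proof -
    \<comment> \<open>The argument of the integer part is 1 + (1 - \<alpha>)(B + 1), so
      \<open>l\<close> is a valid rank.\<close>
    have "0 < (1 - \<alpha>) * (real B + 1)" using \<alpha> by simp
    then have "1 \<le> \<lfloor>real B + 2 - \<alpha> * (real B + 1)\<rfloor>" by (simp add: algebra_simps)
    then have l: "1 \<le> l" unfolding l_def by linarith
    have "ereal (lmmd_stat S n (\<lambda>i. Y i \<omega>)) > mc_quantile \<alpha> B (\<lambda>b. lmmd_stat S n (\<lambda>i. Z b i \<omega>))
        \<longleftrightarrow> J \<omega> \<in> E 0" if \<omega>: "\<omega> \<in> space M" for \<omega>
    proof -
      let ?Z = "\<lambda>b. lmmd_stat S n (\<lambda>i. Z b i \<omega>)"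
      let ?y = "lmmd_stat S n (\<lambda>i. Y i \<omega>)"
      have y: "L 0 (J \<omega>) = ?y" and z: "\<And>b. b \<in> {1..B} \<Longrightarrow> L b (J \<omega>) = ?Z b"
        using L_J \<omega> by (auto simp: V_def)
      have "mc_quantile \<alpha> B ?Z < ereal ?y
          \<longleftrightarrow> l \<le> card {i. i < length (map ?Z [1..<Suc B]) \<and> map ?Z [1..<Suc B] ! i < ?y}"
        unfolding mc_quantile_def l_def[symmetric] by (rule order_statistic_less_iff[OF l])
      also have "card {i. i < length (map ?Z [1..<Suc B]) \<and> map ?Z [1..<Suc B] ! i < ?y}
          = length (filter (\<lambda>b. ?Z b < ?y) [1..<Suc B])"
        by (subst length_filter_conv_card[symmetric]) (simp only: filter_map length_map comp_def)
      also have "\<dots> = card (set (filter (\<lambda>b. ?Z b < ?y) [1..<Suc B]))"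
        by (intro distinct_card[symmetric] distinct_filter distinct_upt)
      \<comment> \<open>Row 0 is never strictly below itself, so counting among the \<open>B\<close>
        copies equals counting among all \<open>B + 1\<close> rows.\<close>
      also have "set (filter (\<lambda>b. ?Z b < ?y) [1..<Suc B]) = {b\<in>{0..B}. L b (J \<omega>) < L 0 (J \<omega>)}"
      proof (rule set_eqI)
        show "b \<in> set (filter (\<lambda>b. ?Z b < ?y) [1..<Suc B]) \<longleftrightarrow> b \<in> {b\<in>{0..B}. L b (J \<omega>) < L 0 (J \<omega>)}" for b
          using y z[of b] by (cases "b = 0") auto
      qed
      finally show ?thesis
        using measurable_space[OF J \<omega>] by (simp add: E_def)
    qed
    then have "{\<omega>\<in>space M. ereal (lmmd_stat S n (\<lambda>i. Y i \<omega>))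
      > mc_quantile \<alpha> B (\<lambda>b. lmmd_stat S n (\<lambda>i. Z b i \<omega>))} = J -` E 0 \<inter> space M"
      by auto
    moreover have "prob (J -` E 0 \<inter> space M) = measure (distr M N J) (E 0)"
      using E_meas[of 0] by (intro measure_distr[symmetric] J) simp
    ultimately show ?thesis by (simp only: law p_def)
  qed
  have le: "(real B + 1) * p \<le> real (Suc B - l)"
    using N.rank_prob_le[of "{0..B}" L l p] L_meas exch by (simp add: E_def add.commute)
  have ge: "real (Suc B - l) \<le> (real B + 1) * p" if ne: "S \<noteq> (\<lambda>_. 0)"
  proof -
    have "AE x in N. inj_on (\<lambda>b. L b x) {0..B}"
    proof -
      have D_meas [measurable]: "closure D \<in> sets borel" by (intro borel_closed closed_closure)
      have fin: "finite I" by (simp add: I_def)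
      note [measurable] = coord
      have all_meas: "{x\<in>space N. \<forall>p\<in>I. x p \<in> closure D} \<in> sets N"
        using fin by measurable
      have "AE x in distr M N J. \<forall>p\<in>I. x p \<in> closure D"
        using J all_meas V_D by (subst AE_distr_iff) (auto simp: J_def)
      then have AE_D: "AE x in N. \<forall>p\<in>I. x p \<in> closure D" by (simp only: law)
      have "AE x in N. L a x \<noteq> L b x" if ab: "a \<in> {0..B}" "b \<in> {0..B}" "a \<noteq> b" for a b
      proof -
        \<comment> \<open>The restriction to \<open>closure D\<close> costs only a null set and lets
          \<open>L a\<close> be replaced by the actual statistic.\<close>
        let ?T = "{x\<in>space N. (\<forall>p\<in>I. x p \<in> closure D) \<and> L a x = L b x}"
        have T: "?T \<in> sets N"
          by (intro sets.sets_Collect_conj all_meas borel_measurable_eq L_meas ab)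
        \<comment> \<open>The first point of row \<open>a\<close> is integrated before all others.
          Row \<open>b\<close> does not contain it, so \<open>L b\<close> is a constant in the inner
          integral and the tie becomes a level set of the statistic in one sample point.\<close>
        define I' where "I' = I - {(a, 1)}"
        have I': "I = insert (a, 1) I'" "finite I'" "(a, 1) \<notin> I'"
          using ab n by (auto simp: I'_def I_def)
        interpret prod: product_sigma_finite "\<lambda>_. P\<^sub>0" by standard
        have "emeasure N ?T = (\<integral>\<^sup>+x. indicator ?T x \<partial>N)" using T by simp
        also have "\<dots> = (\<integral>\<^sup>+y. \<integral>\<^sup>+z. indicator ?T (y((a, 1) := z)) \<partial>P\<^sub>0 \<partial>PiM I' (\<lambda>_. P\<^sub>0))"
        proof -
          have "indicator ?T \<in> borel_measurable (PiM (insert (a, 1) I') (\<lambda>_. P\<^sub>0))"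
            using T unfolding I'(1)[symmetric] N_def[symmetric] by simp
          then show ?thesis
            using prod.product_nn_integral_insert[OF I'(2,3), of "indicator ?T"]
            unfolding I'(1)[symmetric] N_def[symmetric] by simp
        qed
        also have "\<dots> = (\<integral>\<^sup>+y. 0 \<partial>PiM I' (\<lambda>_. P\<^sub>0))"
        proof (rule nn_integral_cong)
          fix y :: "nat \<times> nat \<Rightarrow> 'h"
          let ?A = "{z. lmmd_stat S n ((\<lambda>i. y (a, i))(1 := z)) = L b y}"
          have A: "?A \<in> sets P\<^sub>0"
            unfolding sets_P using n by (intro borel_closed lmmd_stat_level_closed S) auto
          have "z \<in> ?A" if z: "y((a, 1) := z) \<in> ?T" for z
          proof -
            have "(\<lambda>i. y (a, i))(1 := z) = (\<lambda>i. (y((a, 1) := z)) (a, i))" by auto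
            then have "lmmd_stat S n ((\<lambda>i. y (a, i))(1 := z)) = L a (y((a, 1) := z))"
              using L_eq[of "y((a, 1) := z)" a] z ab by (metis (lifting) mem_Collect_eq)
            also have "\<dots> = L b (y((a, 1) := z))" using z by blast
            also have "\<dots> = L b y" using ab by (simp add: L_def)
            finally show ?thesis by simp
          qed
          then have "(\<integral>\<^sup>+z. indicator ?T (y((a, 1) := z)) \<partial>P\<^sub>0) \<le> (\<integral>\<^sup>+z. indicator ?A z \<partial>P\<^sub>0)"
            by (intro nn_integral_mono) (auto simp: indicator_def)
          also have "\<dots> = 0"
            using A n V[of "(a, 1)"] I'(1) lmmd_stat_level_null[OF P0 ne _ M] by simp
          finally show "(\<integral>\<^sup>+z. indicator ?T (y((a, 1) := z)) \<partial>P\<^sub>0) = 0" by simp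
        qed
        finally have "AE x in N. x \<notin> ?T" using T by (intro AE_not_in) (auto simp: null_sets_def)
        with AE_D AE_space show ?thesis by eventually_elim auto
      qed
      then have "AE x in N. \<forall>a\<in>{0..B}. \<forall>b\<in>{0..B}. a \<noteq> b \<longrightarrow> L a x \<noteq> L b x"
        by (intro AE_finite_allI) auto
      then show ?thesis by eventually_elim (auto simp: inj_on_def)
    qed
    then show ?thesis
      using N.rank_prob_ge[of "{0..B}" L l p] L_meas exch by (simp add: E_def add.commute)
  qed
  \<comment> \<open>The two halves of the integer-part inequality give the two bounds after division
    by \<open>B + 1\<close>; \<open>l \<le> Suc B\<close> makes the natural-number subtraction in
    \<open>le\<close> and \<open>ge\<close> exact.\<close>
  have "\<alpha> * (real B + 1) \<ge> 1" using \<alpha>_ge by (simp add: field_simps)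
  moreover have "\<alpha> * (real B + 1) < real B + 1" using \<alpha> by simp
  ultimately have l: "real l \<le> real B + 2 - \<alpha> * (real B + 1)" "real B + 1 - \<alpha> * (real B + 1) < real l" "l \<le> Suc B"
    unfolding l_def by linarith+
  have "p \<le> \<alpha>"
  proof -
    have "(real B + 1) * p \<le> (real B + 1) * \<alpha>" using le l by (simp add: of_nat_diff algebra_simps)
    then show ?thesis by simp
  qed
  moreover have "\<alpha> - 1 / (real B + 1) \<le> p" if "S \<noteq> (\<lambda>_. 0)"
  proof -
    have "(real B + 1) * (\<alpha> - 1 / (real B + 1)) \<le> (real B + 1) * p"
      using ge[OF that] l by (simp add: of_nat_diff algebra_simps)
    then show ?thesis by simp
  qed
  ultimately show ?thesis unfolding Let_def p_eq by blast
qed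

end
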